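(* Assume that for all $j\in\{1,2,\dots,N-1\}$ we have $\beta^2\bigl(1-\cos\bigl(\frac{2\pi j}{N}\bigr)\bigr)\neq2\alpha^2$. Then for every $t\ge0$ the covariance matrices $\Sigma_Z(t)$ of $Z(t)$ and $\Sigma_X(t)$ of $X(t)$ satisfy $$\Sigma_Z(t)=\begin{bmatrix}\frac{\sigma^2}{2\alpha^2\beta}K&0\\0&\sigma^2t\,v_0v_0^*+\frac{\sigma^2}{2\beta}K\end{bmatrix}+\sigma^2\sum_{j=1}^{N-1}\begin{bmatrix}a_j(t)v_jv_j^*&\overline{b_j(t)}\,v_jv_j^*\\ b_j(t)v_jv_j^*&c_j(t)v_jv_j^*\end{bmatrix}$$ and $$\Sigma_X(t)=\begin{bmatrix}\frac{\sigma^2}{2\alpha^2\beta}K&0\\0&\frac{\sigma^2}{2\beta}K\end{bmatrix}+\sigma^2\sum_{j=1}^{N-1}\begin{bmatrix}a_j(t)v_jv_j^*&\overline{b_j(t)}\,v_jv_j^*\\ b_j(t)v_jv_j^*&c_j(t)v_jv_j^*\end{bmatrix},$$ where $$a_j(t)=\frac{\beta\lambda_{j,1}e^{2t\lambda_{j,2}}+4\alpha^2e^{-t\beta\mu_j}+\beta\lambda_{j,2}e^{2t\lambda_{j,1}}}{2\alpha^2\beta\mu_j(\beta^2\mu_j-4\alpha^2)},\qquad c_j(t)=\frac{\lambda_{j,2}\beta e^{2t\lambda_{j,2}}+4\alpha^2e^{-t\beta\mu_j}+\lambda_{j,1}\beta e^{2t\lambda_{j,1}}}{2\beta(\beta^2\mu_j^2-4\alpha^2\mu_j)},$$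 and $$b_j(t)=\frac{\bigl[\beta\mu_j(e^{2t\lambda_{j,2}}+e^{2t\lambda_{j,1}})+2(\lambda_{j,2}+\lambda_{j,1})e^{-t\beta\mu_j}\bigr]\bar\kappa_j}{2\beta\mu_j(\beta^2\mu_j^2-4\alpha^2\mu_j)}.$$
   Context: $N\ge3$ is an integer, $L>0$, $\alpha,\beta\in(0,\infty)$, $\sigma\in\mathbb{R}$, and $W$ is an $N$-dimensional standard Brownian motion. $\mathbf{1}=(1,\dots,1)^\top\in\mathbb{R}^N$ and $I$ is the $N\times N$ identity matrix. $A\in\mathbb{R}^{N\times N}$ is the circulant matrix with $A_{n,n}=-1$ for all $n$, $A_{n,n+1}=1$ for $n\in\{1,\dots,N-1\}$, $A_{N,1}=1$, and all other entries $0$. $$B=\begin{bmatrix}0&A\\-\alpha^2A^\top&-\beta A^\top A\end{bmatrix}\in\mathbb{R}^{2N\times2N},\qquad G=\begin{bmatrix}0\\ \sigma I\end{bmatrix}\in\mathbb{R}^{2N\times N}.$$ $Z(t)=(Q(t),p(t))^\top\in\mathbb{R}^{2N}$ is the solution of the linear SDE $dZ(t)=BZ(t)\,dt+G\,dW(t)$ with deterministic initial value $Z(0)=(Q_0,p_0)^\top$, where $Q_0\in[0,\infty)^N$ satisfies $\sum_{n=1}^N(Q_0)_n=L$ and $p_0\in\mathbb{R}^N$. $M=I-\frac1N\mathbf{1}\mathbf{1}^\top$ and $X(t)=(Q(t),Mp(t))^\top\in\mathbb{R}^{2N}$. The covariance matrices are $\Sigma_Z(t)=\mathbb{E}[(Z(t)-\mathbb{E}Z(t))(Z(t)-\mathbb{E}Z(t))^\top]=\int_0^te^{sB}GG^\top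 e^{sB^\top}ds$ and $\Sigma_X(t)=\mathbb{E}[(X(t)-\mathbb{E}X(t))(X(t)-\mathbb{E}X(t))^\top]$. Further notation: $\omega=e^{2\pi\mathrm{i}/N}$ and, for $j\in\{0,\dots,N-1\}$, $\kappa_j=\omega^j-1$, $v_j=\frac1{\sqrt N}(1,\omega^j,\omega^{2j},\dots,\omega^{(N-1)j})^\top\in\mathbb{C}^N$, $\mu_j=2-2\cos(2\pi j/N)$, and for $k\in\{1,2\}$, $\lambda_{j,k}=\frac12\bigl(-\beta\mu_j+(-1)^k\sqrt{\beta^2\mu_j^2-4\alpha^2\mu_j}\bigr)\in\mathbb{C}$, where the square root of a real number is the principal (complex) one. $K=\sum_{j=1}^{N-1}\frac{v_jv_j^*}{\mu_j}\in\mathbb{C}^{N\times N}$. $^*$ denotes conjugate transpose and a bar denotes complex conjugation. *)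

theory Defs
  imports "HOL-Probability.Probability" "Jordan_Normal_Form.Matrix"
begin

(* Vectors and matrices are those of Jordan_Normal_Form, so indices start at 0: the entry
   with index n in {1..N} in the mathematical text has index n - 1 here. *)

hide_const (open) Finite_Cartesian_Product.vec Finite_Cartesian_Product.mat
  Finite_Cartesian_Product.transpose
no_notation Finite_Cartesian_Product.vec_nth (infixl \<open>$\<close> 90)
no_notation Inner_Product.real_inner_class.inner (infix \<open>\<bullet>\<close> 70)

(* Random vectors are functions from the sample space to vectors of a fixed dimension whose
   components are random variables. *)
definition random_vector :: "'w measure \<Rightarrow> nat \<Rightarrow> ('w \<Rightarrow> real vec) \<Rightarrow> bool" where
  "random_vector P n Y \<longleftrightarrow>
     (\<forall>w\<in>space P. Y w \<in> carrier_vec n) \<and> (\<forall>i<n. (\<lambda>w. Y w $ i) \<in> borel_measurable P)"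

(* The increments over consecutive intervals are independent and an increment over [s, u] is
   N(0, (u - s) I)-distributed.  A vector with law N(0, (u - s) I) is one whose components are
   independent N(0, u - s) variables, so both independence requirements together say that the
   scalar increments W_i(tau (k + 1)) - W_i(tau k) are independent jointly in k and i. *)
definition std_brownian_motion :: "'w measure \<Rightarrow> nat \<Rightarrow> (real \<Rightarrow> 'w \<Rightarrow> real vec) \<Rightarrow> bool" where
  "std_brownian_motion P n W \<longleftrightarrow>
     prob_space P \<and>
     (\<forall>t\<ge>0. random_vector P n (W t)) \<and>
     (AE w in P. W 0 w = 0\<^sub>v n) \<and>
     (\<forall>m (\<tau> :: nat \<Rightarrow> real). 0 \<le> \<tau> 0 \<and> strict_mono \<tau> \<longrightarrow>
        prob_space.indep_vars P (\<lambda>_. borel)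
          (\<lambda>(k, i) w. W (\<tau> (Suc k)) w $ i - W (\<tau> k) w $ i) ({..<m} \<times> {..<n})) \<and>
     (\<forall>s u. 0 \<le> s \<and> s < u \<longrightarrow>
        (\<forall>i<n. distributed P lborel (\<lambda>w. W u w $ i - W s w $ i)
                 (\<lambda>x. ennreal (normal_density 0 (sqrt (u - s)) x)))) \<and>
     (AE w in P. \<forall>i<n. continuous_on {0..} (\<lambda>t. W t w $ i))"

(* Solution of  dZ(t) = B Z(t) dt + G dW(t),  Z(0) = z.  Since G is constant, the stochastic
   integral of G against W over [0, t] is G (W(t) - W(0)) = G W(t), and the SDE is the integral
   equation  Z(t) = z + int_0^t B Z(s) ds + G W(t).  It determines Z pathwise; in particular
   adaptedness of Z to the (augmented) filtration of W need not be required separately. *)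
definition linear_sde_solution ::
  "'w measure \<Rightarrow> (real \<Rightarrow> 'w \<Rightarrow> real vec) \<Rightarrow> real mat \<Rightarrow> real mat \<Rightarrow> real vec \<Rightarrow>
   (real \<Rightarrow> 'w \<Rightarrow> real vec) \<Rightarrow> bool" where
  "linear_sde_solution P W B G z Z \<longleftrightarrow>
     (\<forall>t\<ge>0. random_vector P (dim_vec z) (Z t)) \<and>
     (AE w in P.
        (\<forall>i<dim_vec z. continuous_on {0..} (\<lambda>t. Z t w $ i)) \<and>
        (\<forall>t\<ge>0. Z t w =
           z + vec (dim_vec z) (\<lambda>i. integral {0..t} (\<lambda>s. (B *\<^sub>v Z s w) $ i)) + G *\<^sub>v W t w))"

definition covariance_matrix :: "'w measure \<Rightarrow> nat \<Rightarrow> ('w \<Rightarrow> real vec) \<Rightarrow> real mat" where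
  "covariance_matrix P n Y = mat n n (\<lambda>(r, c).
     integral\<^sup>L P (\<lambda>w. (Y w $ r - integral\<^sup>L P (\<lambda>w'. Y w' $ r)) *
                    (Y w $ c - integral\<^sup>L P (\<lambda>w'. Y w' $ c))))"

definition circ_A :: "nat \<Rightarrow> real mat" where
  "circ_A N = mat N N (\<lambda>(r, c). if c = r then -1 else if c = (r + 1) mod N then 1 else 0)"

definition drift_B :: "nat \<Rightarrow> real \<Rightarrow> real \<Rightarrow> real mat" where
  "drift_B N \<alpha> \<beta> =
     four_block_mat (0\<^sub>m N N) (circ_A N)
       (- (\<alpha>\<^sup>2) \<cdot>\<^sub>m transpose_mat (circ_A N)) (- \<beta> \<cdot>\<^sub>m (transpose_mat (circ_A N) * circ_A N))"

definition diffusion_G :: "nat \<Rightarrow> real \<Rightarrow> real mat" where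
  "diffusion_G N \<sigma> = 0\<^sub>m N N @\<^sub>r (\<sigma> \<cdot>\<^sub>m 1\<^sub>m N)"

definition centering_M :: "nat \<Rightarrow> real mat" where
  "centering_M N = 1\<^sub>m N - (1 / real N) \<cdot>\<^sub>m mat N N (\<lambda>_. 1)"

(* Turns Z = (Q, p) into X = (Q, M p). *)
definition center_momenta :: "nat \<Rightarrow> real vec \<Rightarrow> real vec" where
  "center_momenta N z = vec_first z N @\<^sub>v (centering_M N *\<^sub>v vec_last z N)"

definition root_\<omega> :: "nat \<Rightarrow> complex" where
  "root_\<omega> N = exp (2 * complex_of_real pi * \<i> / of_nat N)"

definition \<kappa> :: "nat \<Rightarrow> nat \<Rightarrow> complex" where
  "\<kappa> N j = root_\<omega> N ^ j - 1"

definition eigvec :: "nat \<Rightarrow> nat \<Rightarrow> complex vec" where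
  "eigvec N j = complex_of_real (1 / sqrt (real N)) \<cdot>\<^sub>v vec N (\<lambda>n. root_\<omega> N ^ (n * j))"

(* the rank-one matrix v_j v_j^* *)
definition eigproj :: "nat \<Rightarrow> nat \<Rightarrow> complex mat" where
  "eigproj N j = mat N N (\<lambda>(r, c). eigvec N j $ r * cnj (eigvec N j $ c))"

definition \<mu> :: "nat \<Rightarrow> nat \<Rightarrow> real" where
  "\<mu> N j = 2 - 2 * cos (2 * pi * real j / real N)"

definition eigval :: "nat \<Rightarrow> real \<Rightarrow> real \<Rightarrow> nat \<Rightarrow> nat \<Rightarrow> complex" where
  "eigval N \<alpha> \<beta> j k =
     (- complex_of_real (\<beta> * \<mu> N j)
        + (-1) ^ k * csqrt (complex_of_real (\<beta>\<^sup>2 * (\<mu> N j)\<^sup>2 - 4 * \<alpha>\<^sup>2 * \<mu> N j))) / 2"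

(* sum of a family of n x m matrices (the type of matrices has no additive unit, so the
   generic sum operator is not available) *)
definition mat_sum :: "nat \<Rightarrow> nat \<Rightarrow> ('j \<Rightarrow> complex mat) \<Rightarrow> 'j set \<Rightarrow> complex mat" where
  "mat_sum n m F S = mat n m (\<lambda>rc. \<Sum>j\<in>S. F j $$ rc)"

definition matrix_K :: "nat \<Rightarrow> complex mat" where
  "matrix_K N = mat_sum N N (\<lambda>j. complex_of_real (1 / \<mu> N j) \<cdot>\<^sub>m eigproj N j) {1..N-1}"

definition coeff_a :: "nat \<Rightarrow> real \<Rightarrow> real \<Rightarrow> nat \<Rightarrow> real \<Rightarrow> complex" where
  "coeff_a N \<alpha> \<beta> j t =
     (of_real \<beta> * eigval N \<alpha> \<beta> j 1 * exp (2 * of_real t * eigval N \<alpha> \<beta> j 2)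
        + of_real (4 * \<alpha>\<^sup>2 * exp (- t * \<beta> * \<mu> N j))
        + of_real \<beta> * eigval N \<alpha> \<beta> j 2 * exp (2 * of_real t * eigval N \<alpha> \<beta> j 1))
     / of_real (2 * \<alpha>\<^sup>2 * \<beta> * \<mu> N j * (\<beta>\<^sup>2 * \<mu> N j - 4 * \<alpha>\<^sup>2))"

definition coeff_b :: "nat \<Rightarrow> real \<Rightarrow> real \<Rightarrow> nat \<Rightarrow> real \<Rightarrow> complex" where
  "coeff_b N \<alpha> \<beta> j t =
     (of_real (\<beta> * \<mu> N j)
          * (exp (2 * of_real t * eigval N \<alpha> \<beta> j 2) + exp (2 * of_real t * eigval N \<alpha> \<beta> j 1))
        + 2 * (eigval N \<alpha> \<beta> j 2 + eigval N \<alpha> \<beta> j 1) * of_real (exp (- t * \<beta> * \<mu> N j)))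
     * cnj (\<kappa> N j)
     / of_real (2 * \<beta> * \<mu> N j * (\<beta>\<^sup>2 * (\<mu> N j)\<^sup>2 - 4 * \<alpha>\<^sup>2 * \<mu> N j))"

definition coeff_c :: "nat \<Rightarrow> real \<Rightarrow> real \<Rightarrow> nat \<Rightarrow> real \<Rightarrow> complex" where
  "coeff_c N \<alpha> \<beta> j t =
     (eigval N \<alpha> \<beta> j 2 * of_real \<beta> * exp (2 * of_real t * eigval N \<alpha> \<beta> j 2)
        + of_real (4 * \<alpha>\<^sup>2 * exp (- t * \<beta> * \<mu> N j))
        + eigval N \<alpha> \<beta> j 1 * of_real \<beta> * exp (2 * of_real t * eigval N \<alpha> \<beta> j 1))
     / of_real (2 * \<beta> * (\<beta>\<^sup>2 * (\<mu> N j)\<^sup>2 - 4 * \<alpha>\<^sup>2 * \<mu> N j))"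

(* the sum over j = 1, ..., N-1 that both covariance matrices share, without the factor sigma^2 *)
definition transient_sum :: "nat \<Rightarrow> real \<Rightarrow> real \<Rightarrow> real \<Rightarrow> complex mat" where
  "transient_sum N \<alpha> \<beta> t = mat_sum (2 * N) (2 * N) (\<lambda>j.
     four_block_mat
       (coeff_a N \<alpha> \<beta> j t \<cdot>\<^sub>m eigproj N j) (cnj (coeff_b N \<alpha> \<beta> j t) \<cdot>\<^sub>m eigproj N j)
       (coeff_b N \<alpha> \<beta> j t \<cdot>\<^sub>m eigproj N j) (coeff_c N \<alpha> \<beta> j t \<cdot>\<^sub>m eigproj N j)) {1..N-1}"

end

theory Submission
  imports Defs
begin

text \<open>
  The discrete Fourier transform diagonalises \<open>A\<close> and \<open>A\<^sup>T\<close> simultaneously and splits the equation into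
  one two-dimensional system per mode \<open>j\<close>, driven by the \<open>j\<close>-th Fourier coefficient of \<open>W\<close>. Because the
  noise is additive, variation of constants can be carried out path by path: up to a deterministic
  term, \<open>q\<^sub>j(t)\<close> and \<open>p\<^sub>j(t)\<close> are \<open>\<sigma>\<close> times the Wiener integrals of \<open>\<kappa>\<^sub>j g\<^sub>j(t - s)\<close> and
  \<open>g\<^sub>j'(t - s)\<close>, where \<open>g\<^sub>j'' + \<beta> \<mu>\<^sub>j g\<^sub>j' + \<alpha>\<^sup>2 \<mu>\<^sub>j g\<^sub>j = 0\<close>, \<open>g\<^sub>j(0) = 0\<close>, \<open>g\<^sub>j'(0) = 1\<close>.
  Such an integral, written by partial integration as \<open>f(t) W(t) - \<integral> f'(s) W(s) ds\<close>, is an almost sure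
  limit of Riemann-Stieltjes sums. Independence of the increments makes these sums Cauchy in
  \<open>L\<^sup>2\<close>, so that the covariances are \<open>\<integral> f(s) cnj (h(s)) ds\<close>. The functions \<open>a\<^sub>j\<close>, \<open>b\<^sub>j\<close>, \<open>c\<^sub>j\<close> are,
  up to constants, the antiderivatives of \<open>\<mu>\<^sub>j g\<^sub>j\<^sup>2\<close>, \<open>cnj \<kappa>\<^sub>j g\<^sub>j g\<^sub>j'\<close> and \<open>g\<^sub>j'\<^sup>2\<close>. Centering the momenta
  removes exactly the mode \<open>j = 0\<close> of \<open>p\<close>.
\<close>

section \<open>Square integrable limits\<close>

text \<open>The Fourier coefficients of \<open>W\<close> are complex, and those of modes j and N - j
  are conjugate to each other, so the noises driving the modes are not all independent. The
  covariances are therefore computed from the real components of \<open>W\<close>: each coordinate,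
  minus a constant, is one Wiener integral whose coefficients form a row of sigma * sum_j b_j(t - s)
  P_j with P_j = \<open>v_j v_j^*\<close>, and the cross terms between modes disappear because P_j
  P_k = 0 for distinct j, k. Noise enters the momenta only, so of each row (a, b) of exp(s B_j) only
  b meets the noise; a is its partner in the differential equation and acts on Q_0. The time
  integrals of products of kernels are increments over [0, t] of a_j, b_j, its conjugate, and c_j.
  Here b_j(0) = 0, while - a_j(0) = 1 / (2 alpha^2 beta mu_j) and - c_j(0) = 1 / (2 beta mu_j) are
  the origin of the two multiples of K. The assumption on the cosines says that the two eigenvalues
  of each mode j > 0 differ; g_j is a quotient by their difference.\<close>

lemma integrable_mult_of_squares:
  fixes f g :: "'a \<Rightarrow> complex"
  assumes [measurable]: "f \<in> borel_measurable M" "g \<in> borel_measurable M"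
    and "integrable M (\<lambda>x. (norm (f x))\<^sup>2)" "integrable M (\<lambda>x. (norm (g x))\<^sup>2)"
  shows "integrable M (\<lambda>x. f x * g x)"
proof (rule Bochner_Integration.integrable_bound)
  show "integrable M (\<lambda>x. (norm (f x))\<^sup>2 + (norm (g x))\<^sup>2)"
    using assms by simp
  have "norm (f x * g x) \<le> (norm (f x))\<^sup>2 + (norm (g x))\<^sup>2" for x
  proof -
    have "0 \<le> norm (f x) * norm (g x)" by simp
    with sum_squares_bound[of "norm (f x)" "norm (g x)"] show ?thesis
      unfolding norm_mult by linarith
  qed
  then show "AE x in M. norm (f x * g x) \<le> norm ((norm (f x))\<^sup>2 + (norm (g x))\<^sup>2)"
    by (auto intro: order_trans[OF _ abs_ge_self])
qed measurable

text \<open>The integral of (|f| - c |g|)^2 is nonnegative for every real c; the best c gives the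
  bound.\<close>

lemma Cauchy_Schwarz_integral:
  fixes f g :: "'a \<Rightarrow> complex"
  assumes [measurable]: "f \<in> borel_measurable M" "g \<in> borel_measurable M"
    and f: "integrable M (\<lambda>x. (norm (f x))\<^sup>2)" and g: "integrable M (\<lambda>x. (norm (g x))\<^sup>2)"
  shows "norm (\<integral>x. f x * g x \<partial>M) \<le> sqrt (\<integral>x. (norm (f x))\<^sup>2 \<partial>M) * sqrt (\<integral>x. (norm (g x))\<^sup>2 \<partial>M)"
proof -
  define F G C where "F = (\<integral>x. (norm (f x))\<^sup>2 \<partial>M)" and "G = (\<integral>x. (norm (g x))\<^sup>2 \<partial>M)"
    and "C = (\<integral>x. norm (f x * g x) \<partial>M)"
  have int: "integrable M (\<lambda>x. norm (f x * g x))"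
    using integrable_mult_of_squares[OF assms] by (rule integrable_norm)
  have quad: "2 * c * C \<le> F + c\<^sup>2 * G" for c
  proof -
    have "0 \<le> (\<integral>x. (norm (f x) - c * norm (g x))\<^sup>2 \<partial>M)"
      by (rule integral_nonneg_AE) simp
    also have "\<dots> = (\<integral>x. (norm (f x))\<^sup>2 + c\<^sup>2 * (norm (g x))\<^sup>2 - 2 * c * norm (f x * g x) \<partial>M)"
      by (rule Bochner_Integration.integral_cong) (auto simp: power2_eq_square norm_mult algebra_simps)
    also have "\<dots> = F + c\<^sup>2 * G - 2 * c * C"
      using f g int by (simp add: F_def G_def C_def)
    finally show ?thesis by simp
  qed
  have "F \<ge> 0" "G \<ge> 0" "C \<ge> 0"
    by (auto simp: F_def G_def C_def)
  have "C\<^sup>2 \<le> F * G"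
  proof (cases "G = 0")
    case True
    have "C = 0"
    proof (rule ccontr)
      assume "C \<noteq> 0"
      \<comment> \<open>For \<open>G = 0\<close> the bound \<open>quad\<close> is linear in c, and
        this c makes its left side 2 F + 2.\<close>
      have "2 * ((F + 1) / C) * C \<le> F"
        using quad[of "(F + 1) / C"] True by simp
      moreover have "2 * ((F + 1) / C) * C = 2 * F + 2"
        using \<open>C \<noteq> 0\<close> by (simp add: field_simps)
      ultimately have "2 * F + 2 \<le> F" by simp
      with \<open>F \<ge> 0\<close> show False by simp
    qed
    then show ?thesis using True by simp
  next
    case False
    \<comment> \<open>c = C / G minimizes F - 2 c C + c^2 G.\<close>
    then have "2 * (C / G) * C \<le> F + (C / G)\<^sup>2 * G" "G > 0"
      using quad[of "C / G"] \<open>G \<ge> 0\<close> by auto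
    then show ?thesis
      by (simp add: field_simps power2_eq_square)
  qed
  then have "C \<le> sqrt F * sqrt G"
    using real_le_rsqrt real_sqrt_mult by metis
  moreover have "norm (\<integral>x. f x * g x \<partial>M) \<le> C"
    unfolding C_def by (rule integral_norm_bound)
  ultimately show ?thesis
    by (simp add: F_def G_def)
qed

lemma power2_norm_add_le: "(norm (a + b :: 'a :: real_normed_vector))\<^sup>2 \<le> 2 * (norm a)\<^sup>2 + 2 * (norm b)\<^sup>2"
proof -
  have "(norm (a + b))\<^sup>2 \<le> (norm a + norm b)\<^sup>2"
    by (intro power_mono norm_triangle_ineq norm_ge_zero)
  also have "\<dots> \<le> 2 * (norm a)\<^sup>2 + 2 * (norm b)\<^sup>2"
    using sum_squares_bound[of "norm a" "norm b"] by (simp add: power2_sum)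
  finally show ?thesis .
qed

lemma integrable_power2_norm_diff:
  fixes f g :: "'a \<Rightarrow> complex"
  assumes [measurable]: "f \<in> borel_measurable M" "g \<in> borel_measurable M"
    and "integrable M (\<lambda>x. (norm (f x))\<^sup>2)" "integrable M (\<lambda>x. (norm (g x))\<^sup>2)"
  shows "integrable M (\<lambda>x. (norm (f x - g x))\<^sup>2)"
proof (rule Bochner_Integration.integrable_bound)
  show "integrable M (\<lambda>x. 2 * (norm (f x))\<^sup>2 + 2 * (norm (g x))\<^sup>2)"
    using assms by simp
  show "AE x in M. norm ((norm (f x - g x))\<^sup>2) \<le> norm (2 * (norm (f x))\<^sup>2 + 2 * (norm (g x))\<^sup>2)"
    using power2_norm_add_le[of "f _" "- g _"] by simp
qed measurable

text \<open>The difference of the products is dX dY + dX Y + X dY, and Cauchy-Schwarz bounds each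
  term. With no conjugate in the product, the lemma serves twice: a conjugated second factor gives
  covariances, the constant factor 1 gives means.\<close>

lemma tendsto_integral_mult_L2:
  fixes X Y :: "'a \<Rightarrow> complex"
  assumes [measurable]: "\<And>n. X' n \<in> borel_measurable M" "\<And>n. Y' n \<in> borel_measurable M"
      "X \<in> borel_measurable M" "Y \<in> borel_measurable M"
    and X': "\<And>n. integrable M (\<lambda>w. (norm (X' n w))\<^sup>2)" and Y': "\<And>n. integrable M (\<lambda>w. (norm (Y' n w))\<^sup>2)"
    and X: "integrable M (\<lambda>w. (norm (X w))\<^sup>2)" and Y: "integrable M (\<lambda>w. (norm (Y w))\<^sup>2)"
    and limX: "(\<lambda>n. \<integral>w. (norm (X' n w - X w))\<^sup>2 \<partial>M) \<longlonglongrightarrow> 0"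
    and limY: "(\<lambda>n. \<integral>w. (norm (Y' n w - Y w))\<^sup>2 \<partial>M) \<longlonglongrightarrow> 0"
  shows "(\<lambda>n. \<integral>w. X' n w * Y' n w \<partial>M) \<longlonglongrightarrow> (\<integral>w. X w * Y w \<partial>M)"
proof -
  define nrm where "nrm f = sqrt (\<integral>w. (norm (f w))\<^sup>2 \<partial>M)" for f :: "'a \<Rightarrow> complex"
  define dX dY where "dX n w = X' n w - X w" and "dY n w = Y' n w - Y w" for n w
  have dX: "integrable M (\<lambda>w. (norm (dX n w))\<^sup>2)" and dY: "integrable M (\<lambda>w. (norm (dY n w))\<^sup>2)" for n
    unfolding dX_def dY_def using X X' Y Y' by (auto intro!: integrable_power2_norm_diff)
  have [measurable]: "dX n \<in> borel_measurable M" "dY n \<in> borel_measurable M" for n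
    by (simp_all add: dX_def[abs_def] dY_def[abs_def])
  have nX: "(\<lambda>n. nrm (dX n)) \<longlonglongrightarrow> 0" and nY: "(\<lambda>n. nrm (dY n)) \<longlonglongrightarrow> 0"
    using tendsto_real_sqrt[OF limX] tendsto_real_sqrt[OF limY] by (simp_all add: nrm_def dX_def dY_def)
  have bound: "norm ((\<integral>w. X' n w * Y' n w \<partial>M) - (\<integral>w. X w * Y w \<partial>M))
      \<le> nrm (dX n) * nrm (dY n) + nrm (dX n) * nrm Y + nrm X * nrm (dY n)" for n
  proof -
    have "(\<integral>w. X' n w * Y' n w \<partial>M) - (\<integral>w. X w * Y w \<partial>M) = (\<integral>w. X' n w * Y' n w - X w * Y w \<partial>M)"
      using X X' Y Y' by (intro Bochner_Integration.integral_diff[symmetric] integrable_mult_of_squares) auto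
    also have "\<dots> = (\<integral>w. dX n w * dY n w + dX n w * Y w + X w * dY n w \<partial>M)"
      by (rule Bochner_Integration.integral_cong) (auto simp: dX_def dY_def algebra_simps)
    also have "\<dots> = (\<integral>w. dX n w * dY n w \<partial>M) + (\<integral>w. dX n w * Y w \<partial>M) + (\<integral>w. X w * dY n w \<partial>M)"
      using X Y dX dY by (simp add: integrable_mult_of_squares)
    also have "norm \<dots> \<le> nrm (dX n) * nrm (dY n) + nrm (dX n) * nrm Y + nrm X * nrm (dY n)"
      unfolding nrm_def using X Y dX dY
      by (intro norm_triangle_le add_mono Cauchy_Schwarz_integral) auto
    finally show ?thesis .
  qed
  have lim: "(\<lambda>n. nrm (dX n) * nrm (dY n) + nrm (dX n) * nrm Y + nrm X * nrm (dY n)) \<longlonglongrightarrow> 0 * 0 + 0 * nrm Y + nrm X * 0"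
    by (intro tendsto_intros nX nY)
  have "(\<lambda>n. (\<integral>w. X' n w * Y' n w \<partial>M) - (\<integral>w. X w * Y w \<partial>M)) \<longlonglongrightarrow> 0"
    by (rule Lim_null_comparison[OF always_eventually lim[simplified]]) (rule allI, rule bound)
  then show ?thesis
    by (rule LIM_zero_cancel)
qed

text \<open>Fatou's lemma replaces the completeness of \<open>L\<^sup>2\<close>.\<close>

lemma L2_limit_of_AE_limit:
  fixes Y :: "'a \<Rightarrow> complex"
  assumes [measurable]: "\<And>n. S n \<in> borel_measurable M" "Y \<in> borel_measurable M"
    and S: "\<And>n. integrable M (\<lambda>w. (norm (S n w))\<^sup>2)"
    and AE: "AE w in M. (\<lambda>n. S n w) \<longlonglongrightarrow> Y w"
    and Cauchy: "\<And>e. e > 0 \<Longrightarrow> \<exists>n0>0. \<forall>n\<ge>n0. \<forall>r>0. (\<integral>w. (norm (S (n * r) w - S n w))\<^sup>2 \<partial>M) \<le> e"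
  shows "integrable M (\<lambda>w. (norm (Y w))\<^sup>2)"
    and "(\<lambda>n. \<integral>w. (norm (S n w - Y w))\<^sup>2 \<partial>M) \<longlonglongrightarrow> 0"
proof -
  have *: "\<exists>n0. \<forall>n\<ge>n0. integrable M (\<lambda>w. (norm (S n w - Y w))\<^sup>2) \<and> (\<integral>w. (norm (S n w - Y w))\<^sup>2 \<partial>M) \<le> e"
    if "e > 0" for e
  proof -
    obtain n0 where "n0 > 0"
      and n0: "\<And>n r. n \<ge> n0 \<Longrightarrow> r > 0 \<Longrightarrow> (\<integral>w. (norm (S (n * r) w - S n w))\<^sup>2 \<partial>M) \<le> e"
      using Cauchy[OF \<open>e > 0\<close>] by blast
    have "integrable M (\<lambda>w. (norm (S n w - Y w))\<^sup>2) \<and> (\<integral>w. (norm (S n w - Y w))\<^sup>2 \<partial>M) \<le> e" if "n \<ge> n0" for n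
    proof -
      have "n > 0" using that \<open>n0 > 0\<close> by simp
      \<comment> \<open>Along the multiples of n, \<open>S\<close> still tends to \<open>Y\<close>,
        so the integrand is a liminf of quantities that the Cauchy condition controls. That
        condition compares n with its multiples only, because these belong to refinements of the
        grid with n cells.\<close>
      have "(\<integral>\<^sup>+w. ennreal ((norm (S n w - Y w))\<^sup>2) \<partial>M)
          = (\<integral>\<^sup>+w. liminf (\<lambda>r. ennreal ((norm (S (n * Suc r) w - S n w))\<^sup>2)) \<partial>M)"
      proof (rule nn_integral_cong_AE)
        show "AE w in M. ennreal ((norm (S n w - Y w))\<^sup>2)
            = liminf (\<lambda>r. ennreal ((norm (S (n * Suc r) w - S n w))\<^sup>2))"
          using AE
        proof eventually_elim
          case (elim w)
          have "filterlim (\<lambda>r. n * Suc r) at_top sequentially"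
            by (rule filterlim_subseq) (use \<open>n > 0\<close> in \<open>auto intro: strict_monoI\<close>)
          from filterlim_compose[OF elim this]
          have "(\<lambda>r. ennreal ((norm (S (n * Suc r) w - S n w))\<^sup>2)) \<longlonglongrightarrow> ennreal ((norm (Y w - S n w))\<^sup>2)"
            by (intro tendsto_ennrealI tendsto_intros)
          then show ?case
            by (subst norm_minus_commute) (rule lim_imp_Liminf[OF sequentially_bot, symmetric])
        qed
      qed
      also have "\<dots> \<le> liminf (\<lambda>r. \<integral>\<^sup>+w. ennreal ((norm (S (n * Suc r) w - S n w))\<^sup>2) \<partial>M)"
        by (rule nn_integral_liminf) measurable
      also have "\<dots> \<le> liminf (\<lambda>r. ennreal e)"
      proof (intro Liminf_mono always_eventually allI)
        fix r
        have "(\<integral>\<^sup>+w. ennreal ((norm (S (n * Suc r) w - S n w))\<^sup>2) \<partial>M)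
            = ennreal (\<integral>w. (norm (S (n * Suc r) w - S n w))\<^sup>2 \<partial>M)"
          by (intro nn_integral_eq_integral integrable_power2_norm_diff S) auto
        also have "\<dots> \<le> ennreal e"
          using n0[OF that, of "Suc r"] by (intro ennreal_leI) auto
        finally show "(\<integral>\<^sup>+w. ennreal ((norm (S (n * Suc r) w - S n w))\<^sup>2) \<partial>M) \<le> ennreal e" .
      qed
      finally have le: "(\<integral>\<^sup>+w. ennreal ((norm (S n w - Y w))\<^sup>2) \<partial>M) \<le> ennreal e"
        by (simp add: Liminf_const)
      have int: "integrable M (\<lambda>w. (norm (S n w - Y w))\<^sup>2)"
        by (rule integrableI_bounded) (use le in \<open>auto simp: order_le_less_trans\<close>)
      with le \<open>e > 0\<close> show ?thesis
        by (simp add: nn_integral_eq_integral)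
    qed
    then show ?thesis by blast
  qed
  show "(\<lambda>n. \<integral>w. (norm (S n w - Y w))\<^sup>2 \<partial>M) \<longlonglongrightarrow> 0"
  proof (rule LIMSEQ_I)
    fix e :: real assume "e > 0"
    then obtain n0 where "\<And>n. n \<ge> n0 \<Longrightarrow> (\<integral>w. (norm (S n w - Y w))\<^sup>2 \<partial>M) \<le> e / 2"
      using *[of "e / 2"] by auto
    then show "\<exists>n0. \<forall>n\<ge>n0. norm ((\<integral>w. (norm (S n w - Y w))\<^sup>2 \<partial>M) - 0) < e"
      using \<open>e > 0\<close> by (intro exI[of _ n0]) (force intro: le_less_trans)
  qed
  obtain n where n: "integrable M (\<lambda>w. (norm (S n w - Y w))\<^sup>2)"
    using *[of 1] by auto
  have "integrable M (\<lambda>w. (norm (S n w - (S n w - Y w)))\<^sup>2)"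
    by (rule integrable_power2_norm_diff) (use S n in auto)
  then show "integrable M (\<lambda>w. (norm (Y w))\<^sup>2)" by simp
qed

section \<open>Wiener integrals\<close>

definition increment :: "real \<Rightarrow> (real \<Rightarrow> 'w \<Rightarrow> real vec) \<Rightarrow> nat \<Rightarrow> nat \<Rightarrow> nat \<Rightarrow> 'w \<Rightarrow> real" where
  "increment t W m k i w = W (real (Suc k) * t / real m) w $ i - W (real k * t / real m) w $ i"

text \<open>A Stieltjes sum over m equal cells of [0, t]. The coefficients depend on the component i
  as well, so that one sum approximates the integral of a row vector against
  \<open>W\<close>.\<close>

definition increment_sum ::
    "nat \<Rightarrow> real \<Rightarrow> (real \<Rightarrow> 'w \<Rightarrow> real vec) \<Rightarrow> nat \<Rightarrow> (nat \<Rightarrow> nat \<Rightarrow> complex) \<Rightarrow> 'w \<Rightarrow> complex" where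
  "increment_sum d t W m a w = (\<Sum>k<m. \<Sum>i<d. a k i * complex_of_real (increment t W m k i w))"

lemma increment_measurable:
  assumes "std_brownian_motion P d W" "t \<ge> 0" "i < d"
  shows "increment t W m k i \<in> borel_measurable P"
proof -
  have "(\<lambda>w. W s w $ i) \<in> borel_measurable P" if "s \<ge> 0" for s
    using assms that by (auto simp: std_brownian_motion_def random_vector_def)
  then show ?thesis
    using assms(2) unfolding increment_def[abs_def] by (intro borel_measurable_diff) auto
qed

lemma increment_sum_measurable:
  assumes "std_brownian_motion P d W" "t \<ge> 0"
  shows "increment_sum d t W m a \<in> borel_measurable P"
  unfolding increment_sum_def[abs_def]
  using increment_measurable[OF assms] by (intro borel_measurable_sum borel_measurable_times) (auto intro!: borel_measurable_of_real)

text \<open>Independence, jointly in the cell and the component, turns the expectation of a product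
  into a product of zero means; on the diagonal the law N(0, t/m) gives the second moment.\<close>

lemma increment_moments:
  assumes bm: "std_brownian_motion P d W" and t: "t \<ge> 0" and k: "k < m" "k' < m" and i: "i < d" "i' < d"
  shows "integrable P (increment t W m k i)"
    and "(\<integral>w. increment t W m k i w \<partial>P) = 0"
    and "integrable P (\<lambda>w. increment t W m k i w * increment t W m k' i' w)"
    and "(\<integral>w. increment t W m k i w * increment t W m k' i' w \<partial>P)
      = (if k = k' \<and> i = i' then t / real m else 0)"
proof -
  interpret prob_space P using bm by (simp add: std_brownian_motion_def)
  define D where "D = (\<lambda>(k, i). increment t W m k i)"
  have *: "integrable P (D p) \<and> expectation (D p) = 0 \<and> integrable P (\<lambda>w. D p w * D q w)
      \<and> expectation (\<lambda>w. D p w * D q w) = (if p = q then t / real m else 0)"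
    if pq: "p \<in> {..<m} \<times> {..<d}" "q \<in> {..<m} \<times> {..<d}" for p q
  \<comment> \<open>For \<open>t = 0\<close> the grid points coincide, so that neither the normal
    law nor the independence of increments is available; all increments vanish instead.\<close>
  proof (cases "t = 0")
    case True
    then have "D p = (\<lambda>_. 0)" for p
      by (auto simp: D_def increment_def fun_eq_iff split: prod.splits)
    with True show ?thesis by simp
  next
    case False
    have m: "m > 0" using pq by auto
    define s where "s = sqrt (t / real m)"
    have s: "s > 0" "s\<^sup>2 = t / real m"
      using False t m by (auto simp: s_def)
    have dist: "distributed P lborel (D p) (\<lambda>x. ennreal (normal_density 0 s x))"
      if p_mem: "p \<in> {..<m} \<times> {..<d}" for p
    proof -
      obtain k i where p: "p = (k, i)" "k < m" "i < d" using p_mem by auto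
      have step: "real (Suc k) * t / real m - real k * t / real m = t / real m"
        by (simp add: diff_divide_distrib[symmetric] algebra_simps)
      have le: "0 \<le> real k * t / real m" "real k * t / real m < real (Suc k) * t / real m"
        using t False m by (auto simp: divide_strict_right_mono)
      have normal: "distributed P lborel (\<lambda>w. W u w $ i - W s w $ i) (\<lambda>x. ennreal (normal_density 0 (sqrt (u - s)) x))"
        if "0 \<le> s" "s < u" for s u
        using bm p(3) that unfolding std_brownian_motion_def by blast
      have "distributed P lborel
          (\<lambda>w. W (real (Suc k) * t / real m) w $ i - W (real k * t / real m) w $ i)
          (\<lambda>x. ennreal (normal_density 0 s x))"
        using normal[OF le] unfolding step s_def .
      then show ?thesis
        by (simp add: D_def p increment_def[abs_def])
    qed
    have int: "integrable P (D p)" and int2: "integrable P (\<lambda>w. (D p w)\<^sup>2)"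
      and E: "expectation (D p) = 0" and V: "expectation (\<lambda>w. (D p w)\<^sup>2) = t / real m"
      if "p \<in> {..<m} \<times> {..<d}" for p
    proof -
      note D = dist[OF that]
      show "integrable P (D p)"
        using integrable_normal_moment_nz_1[OF s(1), of 0] distributed_integrable[OF D, of "\<lambda>x. x"] s by simp
      show "integrable P (\<lambda>w. (D p w)\<^sup>2)"
        using integrable_normal_moment[OF s(1), of 0 2] distributed_integrable[OF D, of "\<lambda>x. x\<^sup>2"] s by simp
      show "expectation (D p) = 0"
        using normal_distributed_expectation[OF s(1) D] .
      then show "expectation (\<lambda>w. (D p w)\<^sup>2) = t / real m"
        using normal_distributed_variance[OF s(1) D] s by simp
    qed
    show ?thesis
    proof (cases "p = q")
      case True
      with int[OF pq(1)] int2[OF pq(1)] E[OF pq(1)] V[OF pq(1)] show ?thesis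
        by (simp add: power2_eq_square)
    next
      case neq: False
      \<comment> \<open>The grid is continued beyond t, since independence is stated for strictly
        increasing sequences indexed by all natural numbers.\<close>
      define \<tau> where "\<tau> k = real k * t / real m" for k
      have "strict_mono \<tau>" "0 \<le> \<tau> 0"
        using t False m by (auto simp: \<tau>_def strict_mono_def divide_strict_right_mono)
      then have "indep_vars (\<lambda>_. borel) (\<lambda>(k, i) w. W (\<tau> (Suc k)) w $ i - W (\<tau> k) w $ i) ({..<m} \<times> {..<d})"
        using bm unfolding std_brownian_motion_def by blast
      also have "(\<lambda>(k, i) w. W (\<tau> (Suc k)) w $ i - W (\<tau> k) w $ i) = D"
        by (auto simp: D_def \<tau>_def increment_def fun_eq_iff)
      finally have "indep_vars (\<lambda>_. borel) D {p, q}"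
        by (rule indep_vars_subset) (use pq in auto)
      \<comment> \<open>The sum over the singleton \<open>{q}\<close> is \<open>D q\<close>; this
        passes from a family of two variables to a pair.\<close>
      then have "indep_var borel (D p) borel (D q)"
        using indep_vars_sum[of "{q}" p D] neq by simp
      note indep_var_integrable[OF this int[OF pq(1)] int[OF pq(2)]]
        indep_var_lebesgue_integral[OF this int[OF pq(1)] int[OF pq(2)]]
      with neq int[OF pq(1)] E[OF pq(1)] show ?thesis
        by simp
    qed
  qed
  show "integrable P (increment t W m k i)" "(\<integral>w. increment t W m k i w \<partial>P) = 0"
    "integrable P (\<lambda>w. increment t W m k i w * increment t W m k' i' w)"
    "(\<integral>w. increment t W m k i w * increment t W m k' i' w \<partial>P)
      = (if k = k' \<and> i = i' then t / real m else 0)"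
    using *[of "(k, i)" "(k', i')"] k i by (auto simp: D_def)
qed

lemma increment_sum_mean:
  assumes "std_brownian_motion P d W" "t \<ge> 0"
  shows "integrable P (increment_sum d t W m a)" "(\<integral>w. increment_sum d t W m a w \<partial>P) = 0"
proof -
  have *: "integrable P (\<lambda>w. a k i * complex_of_real (increment t W m k i w))"
    "(\<integral>w. a k i * complex_of_real (increment t W m k i w) \<partial>P) = 0" if "k < m" "i < d" for k i
    using increment_moments[OF assms that(1,1,2,2)] by simp_all
  then show "integrable P (increment_sum d t W m a)"
    unfolding increment_sum_def[abs_def] by (intro Bochner_Integration.integrable_sum) auto
  have "(\<integral>w. increment_sum d t W m a w \<partial>P)
      = (\<Sum>k<m. \<integral>w. (\<Sum>i<d. a k i * complex_of_real (increment t W m k i w)) \<partial>P)"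
    unfolding increment_sum_def
    by (intro Bochner_Integration.integral_sum Bochner_Integration.integrable_sum) (use * in auto)
  also have "\<dots> = (\<Sum>k<m. \<Sum>i<d. \<integral>w. a k i * complex_of_real (increment t W m k i w) \<partial>P)"
    by (intro sum.cong refl Bochner_Integration.integral_sum) (use * in auto)
  also have "\<dots> = 0"
    by (intro sum.neutral ballI *(2)) auto
  finally show "(\<integral>w. increment_sum d t W m a w \<partial>P) = 0" .
qed

text \<open>The isometry before the limit: in the expanded double sum only the diagonal pairs
  survive, each with weight t/m.\<close>

lemma increment_sum_covariance:
  assumes "std_brownian_motion P d W" "t \<ge> 0"
  shows "integrable P (\<lambda>w. increment_sum d t W m a w * cnj (increment_sum d t W m b w))"
    and "(\<integral>w. increment_sum d t W m a w * cnj (increment_sum d t W m b w) \<partial>P)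
      = complex_of_real (t / real m) * (\<Sum>k<m. \<Sum>i<d. a k i * cnj (b k i))"
proof -
  let ?I = "{..<m} \<times> {..<d}"
  define D where "D = (\<lambda>(k, i). increment t W m k i)"
  define a' b' where "a' = (\<lambda>(k, i). a k i)" and "b' = (\<lambda>(k, i). b k i)"
  have eq: "increment_sum d t W m a w * cnj (increment_sum d t W m b w)
      = (\<Sum>p\<in>?I. \<Sum>q\<in>?I. a' p * cnj (b' q) * complex_of_real (D p w * D q w))" for w
    by (simp add: increment_sum_def sum.cartesian_product sum_product a'_def b'_def D_def split_beta algebra_simps
        flip: of_real_mult)
  have *: "integrable P (\<lambda>w. a' p * cnj (b' q) * complex_of_real (D p w * D q w))"
    "(\<integral>w. a' p * cnj (b' q) * complex_of_real (D p w * D q w) \<partial>P)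
      = (if p = q then a' p * cnj (b' p) * complex_of_real (t / real m) else 0)"
    if mem: "p \<in> ?I" "q \<in> ?I" for p q
  proof -
    obtain k i k' i' where pq: "p = (k, i)" "q = (k', i')" "k < m" "i < d" "k' < m" "i' < d"
      using mem by auto
    note mom = increment_moments(3,4)[OF assms pq(3,5,4,6)]
    show "integrable P (\<lambda>w. a' p * cnj (b' q) * complex_of_real (D p w * D q w))"
      using mom(1) by (intro integrable_mult_right integrable_of_real) (simp add: D_def pq)
    have "(\<integral>w. complex_of_real (D p w * D q w) \<partial>P) = complex_of_real (if p = q then t / real m else 0)"
      unfolding integral_complex_of_real using mom(2) by (simp add: D_def pq)
    then show "(\<integral>w. a' p * cnj (b' q) * complex_of_real (D p w * D q w) \<partial>P)
      = (if p = q then a' p * cnj (b' p) * complex_of_real (t / real m) else 0)"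
      by simp
  qed
  show "integrable P (\<lambda>w. increment_sum d t W m a w * cnj (increment_sum d t W m b w))"
    unfolding eq by (intro Bochner_Integration.integrable_sum *)
  have "(\<integral>w. increment_sum d t W m a w * cnj (increment_sum d t W m b w) \<partial>P)
      = (\<Sum>p\<in>?I. \<Sum>q\<in>?I. \<integral>w. a' p * cnj (b' q) * complex_of_real (D p w * D q w) \<partial>P)"
    unfolding eq
    by (subst Bochner_Integration.integral_sum, intro Bochner_Integration.integrable_sum *, assumption+,
        intro sum.cong refl, subst Bochner_Integration.integral_sum, intro *, assumption+, rule refl)
  also have "\<dots> = (\<Sum>p\<in>?I. a' p * cnj (b' p) * complex_of_real (t / real m))"
    by (intro sum.cong refl) (subst sum.cong[OF refl *(2)], assumption+, simp add: sum.delta')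
  also have "\<dots> = complex_of_real (t / real m) * (\<Sum>k<m. \<Sum>i<d. a k i * cnj (b k i))"
    by (simp add: sum.cartesian_product sum_distrib_left a'_def b'_def split_beta mult_ac)
  finally show "(\<integral>w. increment_sum d t W m a w * cnj (increment_sum d t W m b w) \<partial>P)
      = complex_of_real (t / real m) * (\<Sum>k<m. \<Sum>i<d. a k i * cnj (b k i))" .
qed

lemma increment_sum_norm2:
  assumes "std_brownian_motion P d W" "t \<ge> 0"
  shows "integrable P (\<lambda>w. (norm (increment_sum d t W m a w))\<^sup>2)"
    and "(\<integral>w. (norm (increment_sum d t W m a w))\<^sup>2 \<partial>P) = t / real m * (\<Sum>k<m. \<Sum>i<d. (norm (a k i))\<^sup>2)"
proof -
  let ?S = "increment_sum d t W m a"
  have eq: "?S w * cnj (?S w) = complex_of_real ((norm (?S w))\<^sup>2)" for w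
    by (rule complex_norm_square[symmetric])
  show int: "integrable P (\<lambda>w. (norm (?S w))\<^sup>2)"
    using increment_sum_covariance(1)[OF assms, of m a a] unfolding eq complex_of_real_integrable_eq .
  have "complex_of_real (\<integral>w. (norm (?S w))\<^sup>2 \<partial>P)
      = complex_of_real (t / real m * (\<Sum>k<m. \<Sum>i<d. (norm (a k i))\<^sup>2))"
    using increment_sum_covariance(2)[OF assms, of m a a] unfolding eq integral_complex_of_real
    by (simp only: complex_norm_square of_real_mult of_real_sum)
  then show "(\<integral>w. (norm (?S w))\<^sup>2 \<partial>P) = t / real m * (\<Sum>k<m. \<Sum>i<d. (norm (a k i))\<^sup>2)"
    unfolding of_real_eq_iff .
qed

section \<open>Deterministic limits of sums on uniform grids\<close>

lemma uniform_grid_integral: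
  fixes f :: "real \<Rightarrow> 'a :: banach"
  assumes "f integrable_on {0..t}" "t \<ge> 0" "m > 0"
  shows "(\<Sum>k<m. integral {real k * t / real m..real (Suc k) * t / real m} f) = integral {0..t} f"
proof -
  have "(\<Sum>k<j. integral {real k * t / real m..real (Suc k) * t / real m} f) = integral {0..real j * t / real m} f"
    if "j \<le> m" for j
    using that
  proof (induction j)
    case (Suc j)
    have "real (Suc j) * t \<le> real m * t"
      using Suc.prems assms(2) by (intro mult_right_mono) auto
    then have "real (Suc j) * t / real m \<le> t"
      using assms(3) by (simp add: field_simps)
    then have "integral {0..real j * t / real m} f + integral {real j * t / real m..real (Suc j) * t / real m} f
        = integral {0..real (Suc j) * t / real m} f"
      using assms by (intro Henstock_Kurzweil_Integration.integral_combine integrable_on_subinterval[OF assms(1)])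
        (auto simp: divide_right_mono mult_right_mono)
    with Suc show ?case by simp
  qed simp
  from this[of m] assms(3) show ?thesis by simp
qed

text \<open>Only \<open>w\<close> is sampled, while \<open>h\<close> is integrated exactly over each
  cell, so the error is governed by the modulus of continuity of \<open>w\<close>. The choice h = 1
  gives Riemann sums; h = f' represents the increments of a differentiable f.\<close>

lemma uniform_grid_sum_tendsto_integral:
  fixes w h :: "real \<Rightarrow> complex"
  assumes t: "t \<ge> 0" and w: "continuous_on {0..t} w" and h: "continuous_on {0..t} h"
    and \<xi>: "\<And>m k. k < m \<Longrightarrow> \<xi> m k \<in> {real k * t / real m..real (Suc k) * t / real m}"
  shows "(\<lambda>m. \<Sum>k<m. w (\<xi> m k) * integral {real k * t / real m..real (Suc k) * t / real m} h)
    \<longlonglongrightarrow> integral {0..t} (\<lambda>s. w s * h s)"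
proof (rule LIMSEQ_I)
  fix e :: real assume e: "e > 0"
  have "bounded (h ` {0..t})"
    by (intro compact_imp_bounded compact_continuous_image h) auto
  then obtain B where "B > 0" and B: "\<And>s. s \<in> {0..t} \<Longrightarrow> norm (h s) \<le> B"
    unfolding bounded_pos by auto
  \<comment> \<open>The total error will be at most \<open>\<epsilon> * B * t\<close>, which is e t
    / (2 (t + 1)) < e; t + 1 keeps the denominator positive for t = 0.\<close>
  define \<epsilon> where "\<epsilon> = e / (2 * B * (t + 1))"
  have "\<epsilon> > 0" using e t \<open>B > 0\<close> by (simp add: \<epsilon>_def)
  have "uniformly_continuous_on {0..t} w"
    by (rule compact_uniformly_continuous[OF w]) auto
  then obtain \<delta> where "\<delta> > 0"
    and \<delta>: "\<And>x y. x \<in> {0..t} \<Longrightarrow> y \<in> {0..t} \<Longrightarrow> dist y x < \<delta> \<Longrightarrow> dist (w y) (w x) < \<epsilon>"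
    using \<open>\<epsilon> > 0\<close> unfolding uniformly_continuous_on_def by blast
  obtain m0 :: nat where m0: "t / \<delta> < real m0"
    using reals_Archimedean2 by blast
  have "norm ((\<Sum>k<m. w (\<xi> m k) * integral {real k * t / real m..real (Suc k) * t / real m} h)
      - integral {0..t} (\<lambda>s. w s * h s)) < e" if "m \<ge> max 1 m0" for m
  proof -
    define \<tau> where "\<tau> k = real k * t / real m" for k
    have m: "m > 0" "t / real m < \<delta>"
    proof -
      show "m > 0" using that by simp
      have "t / \<delta> < real m" using m0 that by (auto intro: less_le_trans)
      then show "t / real m < \<delta>" using \<open>\<delta> > 0\<close> \<open>m > 0\<close> by (simp add: field_simps)
    qed
    have \<tau>_mono: "\<tau> k \<le> \<tau> (Suc k)" and \<tau>_diff: "\<tau> (Suc k) - \<tau> k = t / real m" for k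
      using t m by (auto simp: \<tau>_def divide_right_mono mult_right_mono diff_divide_distrib[symmetric] algebra_simps)
    have sub: "{\<tau> k..\<tau> (Suc k)} \<subseteq> {0..t}" if "k < m" for k
    proof -
      have "real (Suc k) * t \<le> real m * t"
        using that t by (intro mult_right_mono) auto
      then have "\<tau> (Suc k) \<le> t" using m by (simp add: \<tau>_def field_simps)
      then show ?thesis using t by (auto simp: \<tau>_def intro: order_trans[rotated])
    qed
    have "norm (w (\<xi> m k) * integral {\<tau> k..\<tau> (Suc k)} h - integral {\<tau> k..\<tau> (Suc k)} (\<lambda>s. w s * h s))
        \<le> \<epsilon> * B * (t / real m)" if "k < m" for k
    proof -
      note cont = continuous_on_subset[OF w sub[OF that]] continuous_on_subset[OF h sub[OF that]]
      have \<xi>k: "\<xi> m k \<in> {\<tau> k..\<tau> (Suc k)}" using \<xi>[OF that] by (simp add: \<tau>_def)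
      have "w (\<xi> m k) * integral {\<tau> k..\<tau> (Suc k)} h - integral {\<tau> k..\<tau> (Suc k)} (\<lambda>s. w s * h s)
          = integral {\<tau> k..\<tau> (Suc k)} (\<lambda>s. (w (\<xi> m k) - w s) * h s)"
        unfolding left_diff_distrib integral_mult_right[symmetric]
        by (intro integral_diff[symmetric] integrable_continuous_real continuous_intros cont)
      also have "norm \<dots> \<le> \<epsilon> * B * (\<tau> (Suc k) - \<tau> k)"
      proof (rule integral_bound)
        fix s assume s: "s \<in> {\<tau> k..\<tau> (Suc k)}"
        have "dist (\<xi> m k) s \<le> \<tau> (Suc k) - \<tau> k"
          using s \<xi>k by (auto simp: dist_real_def)
        then have "dist (w (\<xi> m k)) (w s) < \<epsilon>"
          using m(2) \<tau>_diff[of k] s \<xi>k sub[OF that] by (intro \<delta>) auto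
        then have "norm (w (\<xi> m k) - w s) * norm (h s) \<le> \<epsilon> * B"
          using B s sub[OF that] \<open>\<epsilon> > 0\<close> by (intro mult_mono) (auto simp: dist_norm)
        then show "norm ((w (\<xi> m k) - w s) * h s) \<le> \<epsilon> * B" by (simp add: norm_mult)
      qed (intro \<tau>_mono continuous_intros cont)+
      finally show ?thesis by (simp add: \<tau>_diff)
    qed
    then have "norm (\<Sum>k<m. w (\<xi> m k) * integral {\<tau> k..\<tau> (Suc k)} h - integral {\<tau> k..\<tau> (Suc k)} (\<lambda>s. w s * h s))
        \<le> (\<Sum>k<m. \<epsilon> * B * (t / real m))"
      by (intro sum_norm_le) auto
    also have "\<dots> = \<epsilon> * B * t" using m by simp
    also have "\<dots> < e"
    proof -
      have "\<epsilon> * B * t = e * t / (2 * (t + 1))" using \<open>B > 0\<close> by (simp add: \<epsilon>_def)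
      also have "\<dots> < e"
      proof -
        have "0 \<le> e * t" using e t by simp
        then show ?thesis using e t by (simp add: field_simps add_nonneg_pos)
      qed
      finally show ?thesis .
    qed
    also have "(\<Sum>k<m. w (\<xi> m k) * integral {\<tau> k..\<tau> (Suc k)} h - integral {\<tau> k..\<tau> (Suc k)} (\<lambda>s. w s * h s))
        = (\<Sum>k<m. w (\<xi> m k) * integral {\<tau> k..\<tau> (Suc k)} h) - integral {0..t} (\<lambda>s. w s * h s)"
      unfolding sum_subtractf \<tau>_def using t m w h
      by (subst uniform_grid_integral) (auto intro!: integrable_continuous_real continuous_intros)
    finally show ?thesis by (simp add: \<tau>_def)
  qed
  then show "\<exists>m0. \<forall>m\<ge>m0. norm ((\<Sum>k<m. w (\<xi> m k) * integral {real k * t / real m..real (Suc k) * t / real m} h)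
      - integral {0..t} (\<lambda>s. w s * h s)) < e"
    by blast
qed

lemma riemann_sum_tendsto:
  fixes f :: "real \<Rightarrow> complex"
  assumes "t \<ge> 0" "continuous_on {0..t} f"
  shows "(\<lambda>m. complex_of_real (t / real m) * (\<Sum>k<m. f (real k * t / real m))) \<longlonglongrightarrow> integral {0..t} f"
proof -
  have "(\<lambda>m. \<Sum>k<m. f (real k * t / real m) * integral {real k * t / real m..real (Suc k) * t / real m} (\<lambda>_. 1))
      \<longlonglongrightarrow> integral {0..t} (\<lambda>s. f s * 1)"
    using assms by (intro uniform_grid_sum_tendsto_integral) (auto simp: divide_right_mono mult_right_mono)
  moreover have "integral {real k * t / real m..real (Suc k) * t / real m} (\<lambda>_. 1 :: complex) = complex_of_real (t / real m)" for k m
    using assms(1) by (simp add: divide_right_mono mult_right_mono diff_divide_distrib[symmetric] algebra_simps scaleR_conv_of_real)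
  ultimately show ?thesis
    by (simp only: mult_1_right sum_distrib_left[symmetric] mult.commute[of _ "complex_of_real _"])
qed

text \<open>\<open>w\<close> will be a Fourier coefficient of a Brownian path and is merely
  continuous; summation by parts moves the differences to the smooth factor
  \<open>f\<close>.\<close>

lemma riemann_stieltjes_sum_tendsto:
  fixes f f' w :: "real \<Rightarrow> complex"
  assumes t: "t \<ge> 0" and w: "continuous_on {0..t} w" and w0: "w 0 = 0"
    and f: "\<And>s. s \<in> {0..t} \<Longrightarrow> (f has_vector_derivative f' s) (at s within {0..t})"
    and f': "continuous_on {0..t} f'"
  shows "(\<lambda>m. \<Sum>k<m. f (real k * t / real m) * (w (real (Suc k) * t / real m) - w (real k * t / real m)))
    \<longlonglongrightarrow> f t * w t - integral {0..t} (\<lambda>s. f' s * w s)"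
proof -
  \<comment> \<open>With F sampled at left end points, G comes out at right end points. The boundary
    term F 0 * G 0 will vanish by \<open>w 0 = 0\<close>.\<close>
  have parts: "(\<Sum>k<m. F k * (G (Suc k) - G k)) = F m * G m - F 0 * G 0 - (\<Sum>k<m. G (Suc k) * (F (Suc k) - F k))"
    for F G :: "nat \<Rightarrow> complex" and m
    by (induction m) (auto simp: algebra_simps)
  have "(\<lambda>m. \<Sum>k<m. w (real (Suc k) * t / real m) * integral {real k * t / real m..real (Suc k) * t / real m} f')
      \<longlonglongrightarrow> integral {0..t} (\<lambda>s. w s * f' s)"
    using assms by (intro uniform_grid_sum_tendsto_integral) (auto simp: divide_right_mono mult_right_mono)
  then have lim: "(\<lambda>m. f t * w t - (\<Sum>k<m. w (real (Suc k) * t / real m) * integral {real k * t / real m..real (Suc k) * t / real m} f'))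
      \<longlonglongrightarrow> f t * w t - integral {0..t} (\<lambda>s. f' s * w s)"
    unfolding mult.commute[of "w _" "f' _"] by (intro tendsto_intros)
  show ?thesis
  proof (rule Lim_transform_eventually[OF lim eventually_mono[OF eventually_gt_at_top[of 0]]])
    fix m :: nat assume m: "m > 0"
    have "integral {real k * t / real m..real (Suc k) * t / real m} f'
        = f (real (Suc k) * t / real m) - f (real k * t / real m)" if "k < m" for k
    proof (rule integral_unique, rule fundamental_theorem_of_calculus[where f = f])
      have "real (Suc k) * t \<le> real m * t"
        using that t by (intro mult_right_mono) auto
      then have "real (Suc k) * t / real m \<le> t" using m by (simp add: field_simps)
      moreover have "0 \<le> real k * t / real m" using t by simp
      ultimately have sub: "{real k * t / real m..real (Suc k) * t / real m} \<subseteq> {0..t}"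
        by auto
      show "(f has_vector_derivative f' s) (at s within {real k * t / real m..real (Suc k) * t / real m})"
        if "s \<in> {real k * t / real m..real (Suc k) * t / real m}" for s
        using f that sub by (meson has_vector_derivative_within_subset subsetD)
    qed (use t in \<open>auto simp: divide_right_mono mult_right_mono\<close>)
    then show "f t * w t - (\<Sum>k<m. w (real (Suc k) * t / real m) * integral {real k * t / real m..real (Suc k) * t / real m} f')
        = (\<Sum>k<m. f (real k * t / real m) * (w (real (Suc k) * t / real m) - w (real k * t / real m)))"
      using m w0 by (subst parts) simp
  qed
qed

section \<open>Refinement of grids and passage to the limit\<close>

lemma increment_sum_refine:
  assumes "r > 0"
  shows "increment_sum d t W n a w = increment_sum d t W (n * r) (\<lambda>k i. a (k div r) i) w"
proof -
  have "increment_sum d t W (n * r) (\<lambda>k i. a (k div r) i) w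
      = (\<Sum>k<n. \<Sum>l=k*r..<k*r+r. \<Sum>i<d. a (l div r) i * complex_of_real (increment t W (n * r) l i w))"
    unfolding increment_sum_def by (rule sum.nat_group[symmetric])
  also have "\<dots> = (\<Sum>k<n. \<Sum>i<d. a k i * (\<Sum>l=k*r..<k*r+r. complex_of_real (increment t W (n * r) l i w)))"
  proof (rule sum.cong[OF refl])
    fix k
    have "(\<Sum>l=k*r..<k*r+r. \<Sum>i<d. a (l div r) i * complex_of_real (increment t W (n * r) l i w))
        = (\<Sum>l=k*r..<k*r+r. \<Sum>i<d. a k i * complex_of_real (increment t W (n * r) l i w))"
    proof (rule sum.cong[OF refl], rule sum.cong[OF refl])
      fix l i assume "l \<in> {k*r..<k*r+r}"
      then have "l div r = k" by (intro div_nat_eqI) (auto simp: algebra_simps)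
      then show "a (l div r) i * complex_of_real (increment t W (n * r) l i w)
        = a k i * complex_of_real (increment t W (n * r) l i w)" by simp
    qed
    then show "(\<Sum>l=k*r..<k*r+r. \<Sum>i<d. a (l div r) i * complex_of_real (increment t W (n * r) l i w))
        = (\<Sum>i<d. a k i * (\<Sum>l=k*r..<k*r+r. complex_of_real (increment t W (n * r) l i w)))"
      by (subst (asm) sum.swap) (simp add: sum_distrib_left)
  qed
  also have "\<dots> = increment_sum d t W n a w"
  proof -
    \<comment> \<open>The r fine increments inside one coarse cell telescope.\<close>
    have "(\<Sum>l=k*r..<k*r+r. increment t W (n * r) l i w) = increment t W n k i w" for k i
    proof -
      have "(\<Sum>l=k*r..<k*r+r. increment t W (n * r) l i w)
          = W (real (k * r + r) * t / real (n * r)) w $ i - W (real (k * r) * t / real (n * r)) w $ i"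
        unfolding increment_def by (rule sum_Suc_diff') simp
      moreover have "real (k * r + r) * t / real (n * r) = real (Suc k) * t / real n"
        "real (k * r) * t / real (n * r) = real k * t / real n"
        using assms by (cases "n = 0"; simp add: field_simps)+
      ultimately show ?thesis by (simp add: increment_def)
    qed
    then show ?thesis
      by (simp add: increment_sum_def flip: of_real_sum)
  qed
  finally show ?thesis ..
qed

lemma increment_sum_diff:
  "increment_sum d t W m a w - increment_sum d t W m b w = increment_sum d t W m (\<lambda>k i. a k i - b k i) w"
  by (simp add: increment_sum_def sum_subtractf left_diff_distrib)

text \<open>On the common refinement the difference is again an increment sum. Its coefficients
  compare values of \<open>f i\<close> at points less than one coarse cell apart, hence are
  uniformly small, and \<open>increment_sum_norm2\<close> turns this into a bound on the second
  moment.\<close>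

lemma stieltjes_increment_sums_Cauchy:
  assumes bm: "std_brownian_motion P d W" and t: "t \<ge> 0"
    and f: "\<And>i. i < d \<Longrightarrow> continuous_on {0..t} (f i)" and e: "e > 0"
  shows "\<exists>n0>0. \<forall>n\<ge>n0. \<forall>r>0.
    (\<integral>w. (norm (increment_sum d t W (n * r) (\<lambda>k i. f i (real k * t / real (n * r))) w
      - increment_sum d t W n (\<lambda>k i. f i (real k * t / real n)) w))\<^sup>2 \<partial>P) \<le> e"
proof -
  \<comment> \<open>The second moment will be at most
    \<open>t * real d * \<epsilon>\<^sup>2\<close>; the added ones avoid a zero denominator.\<close>
  define \<epsilon> where "\<epsilon> = sqrt (e / ((t + 1) * (real d + 1)))"
  have \<epsilon>: "\<epsilon> > 0" "\<epsilon>\<^sup>2 = e / ((t + 1) * (real d + 1))"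
    using e t by (auto simp: \<epsilon>_def)
  have "\<exists>\<delta>>0. \<forall>x\<in>{0..t}. \<forall>y\<in>{0..t}. dist y x < \<delta> \<longrightarrow> dist (f i y) (f i x) < \<epsilon>" if "i < d" for i
    using compact_uniformly_continuous[OF f[OF that]] \<epsilon> unfolding uniformly_continuous_on_def by auto
  then obtain D where D: "\<And>i. i < d \<Longrightarrow> D i > 0"
    "\<And>i x y. i < d \<Longrightarrow> x \<in> {0..t} \<Longrightarrow> y \<in> {0..t} \<Longrightarrow> dist y x < D i \<Longrightarrow> dist (f i y) (f i x) < \<epsilon>"
    by metis
  \<comment> \<open>The inserted 1 keeps the minimum meaningful for d = 0.\<close>
  define \<delta> where "\<delta> = Min (insert 1 (D ` {..<d}))"
  have \<delta>: "\<delta> > 0" "\<And>i. i < d \<Longrightarrow> \<delta> \<le> D i"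
    using D(1) by (auto simp: \<delta>_def)
  obtain n0 :: nat where n0: "t / \<delta> < real n0"
    using reals_Archimedean2 by blast
  have "(\<integral>w. (norm (increment_sum d t W (n * r) (\<lambda>k i. f i (real k * t / real (n * r))) w
      - increment_sum d t W n (\<lambda>k i. f i (real k * t / real n)) w))\<^sup>2 \<partial>P) \<le> e"
    if n: "n \<ge> max 1 n0" and r: "r > 0" for n r
  proof -
    define c where "c k i = f i (real k * t / real (n * r)) - f i (real (k div r) * t / real n)" for k i
    have n_pos: "n > 0" using n by simp
    have small: "t / real n < \<delta>"
    proof -
      have "t / \<delta> < real n" using n0 n by (auto intro: less_le_trans)
      then show ?thesis using \<delta>(1) n_pos by (simp add: field_simps)
    qed
    have c: "(norm (c k i))\<^sup>2 \<le> \<epsilon>\<^sup>2" if "k < n * r" "i < d" for k i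
    proof -
      define x y where "x = real (k div r) * t / real n" and "y = real k * t / real (n * r)"
      have "k div r < n" using that r by (simp add: less_mult_imp_div_less)
      then have "real (k div r) * t \<le> real n * t" "real k * t \<le> real (n * r) * t"
        using that t by (intro mult_right_mono; simp del: of_nat_mult)+
      then have "x \<in> {0..t}" "y \<in> {0..t}"
        using t n_pos r by (auto simp: x_def y_def field_simps)
      moreover have "dist y x < D i"
      proof -
        \<comment> \<open>A fine grid point exceeds the left end of its coarse cell by the fraction
          (k mod r) / r of the mesh t / n.\<close>
        have "real k = real (k div r) * real r + real (k mod r)"
          by (metis div_mult_mod_eq of_nat_add of_nat_mult)
        then have "y - x = real (k mod r) / real r * (t / real n)"
          using n_pos r unfolding x_def y_def by (simp add: field_simps)
        moreover have "0 \<le> real (k mod r) / real r" "real (k mod r) / real r \<le> 1"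
          using r by (auto simp: less_imp_le)
        moreover have "real (k mod r) / real r * (t / real n) \<le> 1 * (t / real n)"
          using t r by (intro mult_right_mono) (auto simp: less_imp_le)
        ultimately have "0 \<le> y - x" "y - x \<le> t / real n"
          using t by simp_all
        then show ?thesis using small \<delta>(2)[OF that(2)] by (simp add: dist_real_def)
      qed
      ultimately have "norm (c k i) \<le> \<epsilon>"
        using D(2)[OF that(2), of x y] by (simp add: c_def x_def y_def dist_norm)
      then show ?thesis by (rule power_mono) simp
    qed
    have "(\<integral>w. (norm (increment_sum d t W (n * r) (\<lambda>k i. f i (real k * t / real (n * r))) w
        - increment_sum d t W n (\<lambda>k i. f i (real k * t / real n)) w))\<^sup>2 \<partial>P)
        = (\<integral>w. (norm (increment_sum d t W (n * r) c w))\<^sup>2 \<partial>P)"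
      unfolding increment_sum_refine[OF r, of d t W n] increment_sum_diff c_def ..
    also have "\<dots> = t / real (n * r) * (\<Sum>k<n * r. \<Sum>i<d. (norm (c k i))\<^sup>2)"
      by (rule increment_sum_norm2[OF bm t])
    also have "\<dots> \<le> t / real (n * r) * (\<Sum>k<n * r. \<Sum>i<d. \<epsilon>\<^sup>2)"
      using t by (intro mult_left_mono sum_mono c) auto
    also have "\<dots> = t * real d * \<epsilon>\<^sup>2"
      using n_pos r by simp
    also have "\<dots> \<le> (t + 1) * (real d + 1) * \<epsilon>\<^sup>2"
      using t by (intro mult_mono) auto
    also have "\<dots> = e" using \<epsilon>(2) t by simp
    finally show ?thesis .
  qed
  then show ?thesis by (intro exI[of _ "max 1 n0"]) auto
qed

text \<open>A Wiener integral enters as any measurable almost sure limit of its sums, which is what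
  the pathwise formula supplies. The discrete covariance then has two limits: E[X cnj Y] by
  convergence in L2, and the time integral because it is a sum of Riemann sums.\<close>

theorem wiener_isometry:
  assumes bm: "std_brownian_motion P d W" and t: "t \<ge> 0"
    and f: "\<And>i. i < d \<Longrightarrow> continuous_on {0..t} (f i)" and g: "\<And>i. i < d \<Longrightarrow> continuous_on {0..t} (g i)"
    and [measurable]: "X \<in> borel_measurable P" "Y \<in> borel_measurable P"
    and X: "AE w in P. (\<lambda>m. increment_sum d t W m (\<lambda>k i. f i (real k * t / real m)) w) \<longlonglongrightarrow> X w"
    and Y: "AE w in P. (\<lambda>m. increment_sum d t W m (\<lambda>k i. g i (real k * t / real m)) w) \<longlonglongrightarrow> Y w"
  shows "integrable P X" "(\<integral>w. X w \<partial>P) = 0"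
    and "(\<integral>w. X w * cnj (Y w) \<partial>P) = (\<Sum>i<d. integral {0..t} (\<lambda>s. f i s * cnj (g i s)))"
proof -
  interpret prob_space P using bm by (simp add: std_brownian_motion_def)
  let ?S = "\<lambda>f m. increment_sum d t W m (\<lambda>k i. f i (real k * t / real m))"
  have [measurable]: "?S f m \<in> borel_measurable P" for f m
    by (rule increment_sum_measurable[OF bm t])
  have S2: "integrable P (\<lambda>w. (norm (?S f m w))\<^sup>2)" for f m
    by (rule increment_sum_norm2[OF bm t])
  have X2: "integrable P (\<lambda>w. (norm (X w))\<^sup>2)" "(\<lambda>m. \<integral>w. (norm (?S f m w - X w))\<^sup>2 \<partial>P) \<longlonglongrightarrow> 0"
    using L2_limit_of_AE_limit[OF _ _ S2 X stieltjes_increment_sums_Cauchy[OF bm t f]] by simp_all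
  have Y2: "integrable P (\<lambda>w. (norm (Y w))\<^sup>2)" "(\<lambda>m. \<integral>w. (norm (?S g m w - Y w))\<^sup>2 \<partial>P) \<longlonglongrightarrow> 0"
    using L2_limit_of_AE_limit[OF _ _ S2 Y stieltjes_increment_sums_Cauchy[OF bm t g]] by simp_all
  have cnj_measurable: "cnj \<in> borel_measurable borel"
    by (intro borel_measurable_continuous_onI continuous_intros)
  show "integrable P X"
    using integrable_mult_of_squares[of X P "\<lambda>_. 1"] X2(1) by simp
  \<comment> \<open>The constant 1 is square integrable on a probability space, so the zero means
    pass to the limit.\<close>
  have "(\<lambda>m. \<integral>w. ?S f m w * 1 \<partial>P) \<longlonglongrightarrow> (\<integral>w. X w * 1 \<partial>P)"
    by (rule tendsto_integral_mult_L2) (use S2 X2 in simp_all)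
  then show "(\<integral>w. X w \<partial>P) = 0"
    by (simp add: increment_sum_mean[OF bm t] LIMSEQ_const_iff)
  have "(\<lambda>m. \<integral>w. ?S f m w * cnj (?S g m w) \<partial>P) \<longlonglongrightarrow> (\<integral>w. X w * cnj (Y w) \<partial>P)"
    using S2 X2 Y2
    by (intro tendsto_integral_mult_L2 measurable_compose[OF _ cnj_measurable])
      (simp_all flip: complex_cnj_diff)
  moreover have "(\<lambda>m. \<integral>w. ?S f m w * cnj (?S g m w) \<partial>P) \<longlonglongrightarrow> (\<Sum>i<d. integral {0..t} (\<lambda>s. f i s * cnj (g i s)))"
  proof -
    have "(\<integral>w. ?S f m w * cnj (?S g m w) \<partial>P)
        = (\<Sum>i<d. complex_of_real (t / real m) * (\<Sum>k<m. f i (real k * t / real m) * cnj (g i (real k * t / real m))))" for m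
      unfolding increment_sum_covariance(2)[OF bm t] by (subst sum.swap) (simp add: sum_distrib_left)
    moreover have "(\<lambda>m. \<Sum>i<d. complex_of_real (t / real m) * (\<Sum>k<m. f i (real k * t / real m) * cnj (g i (real k * t / real m))))
        \<longlonglongrightarrow> (\<Sum>i<d. integral {0..t} (\<lambda>s. f i s * cnj (g i s)))"
      using t f g by (intro tendsto_sum riemann_sum_tendsto continuous_intros) auto
    ultimately show ?thesis by simp
  qed
  ultimately show "(\<integral>w. X w * cnj (Y w) \<partial>P) = (\<Sum>i<d. integral {0..t} (\<lambda>s. f i s * cnj (g i s)))"
    by (rule LIMSEQ_unique)
qed

section \<open>Fourier modes\<close>

lemma root_power: "root_\<omega> N ^ k = exp (2 * complex_of_real pi * \<i> * of_nat k / of_nat N)"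
  by (simp add: root_\<omega>_def exp_of_nat_mult[symmetric] mult_ac)

lemma root_power_N: "N > 0 \<Longrightarrow> root_\<omega> N ^ N = 1"
  by (simp add: root_power exp_two_pi_i)

lemma root_power_mod: "N > 0 \<Longrightarrow> root_\<omega> N ^ (k mod N * j) = root_\<omega> N ^ (k * j)"
proof -
  assume "N > 0"
  have "root_\<omega> N ^ (k * j) = (root_\<omega> N ^ (k div N * N + k mod N)) ^ j"
    by (simp add: power_mult)
  also have "root_\<omega> N ^ (k div N * N + k mod N) = root_\<omega> N ^ (k mod N)"
    using root_power_N[OF \<open>N > 0\<close>] by (simp only: power_add mult.commute[of _ N] power_mult) simp
  finally show ?thesis by (simp add: power_mult)
qed

lemma root_mult_cnj: "root_\<omega> N ^ k * cnj (root_\<omega> N ^ k) = 1"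
proof -
  have "root_\<omega> N ^ k = cis (2 * pi * real k / real N)"
    by (simp add: root_power cis_conv_exp mult_ac)
  then show ?thesis by (simp only: cis_cnj cis_mult) simp
qed

lemma root_power_inject: "j < N \<Longrightarrow> k < N \<Longrightarrow> root_\<omega> N ^ j = root_\<omega> N ^ k \<longleftrightarrow> j = k"
  using complex_root_unity_eq[of N j k] by (simp add: root_power)

section \<open>The orthonormal Fourier basis and its projections\<close>

lemma eigvec_index: "n < N \<Longrightarrow> eigvec N j $ n = complex_of_real (1 / sqrt (real N)) * root_\<omega> N ^ (n * j)"
  by (simp add: eigvec_def)

lemma eigvec_index_swap: "n < N \<Longrightarrow> j < N \<Longrightarrow> eigvec N j $ n = eigvec N n $ j"
  by (simp add: eigvec_index mult.commute)

text \<open>Up to the factor 1/N this is a geometric sum in z = omega^(j - k), an N-th root of unity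
  that equals 1 exactly for j = k.\<close>

lemma eigvec_orthonormal:
  assumes "j < N" "k < N"
  shows "(\<Sum>n<N. eigvec N j $ n * cnj (eigvec N k $ n)) = (if j = k then 1 else 0)"
proof -
  define z where "z = root_\<omega> N ^ j * cnj (root_\<omega> N ^ k)"
  have "z ^ N = (root_\<omega> N ^ N) ^ j * cnj ((root_\<omega> N ^ N) ^ k)"
    by (simp add: z_def power_mult_distrib mult.commute flip: power_mult)
  then have zN: "z ^ N = 1" using assms by (simp add: root_power_N)
  have "z = 1 \<longleftrightarrow> j = k"
  proof
    assume "z = 1"
    then have "root_\<omega> N ^ j * (root_\<omega> N ^ k * cnj (root_\<omega> N ^ k)) = root_\<omega> N ^ k"
      by (simp add: z_def mult_ac)
    then show "j = k" using assms by (simp add: root_mult_cnj root_power_inject del: complex_cnj_power)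
  qed (simp add: z_def root_mult_cnj del: complex_cnj_power)
  moreover have "(\<Sum>n<N. z ^ n) = (if z = 1 then of_nat N else 0)"
    using zN by (auto simp: geometric_sum)
  moreover have "eigvec N j $ n * cnj (eigvec N k $ n) = z ^ n / of_nat N" if "n < N" for n
  proof -
    have "complex_of_real (1 / sqrt (real N)) * complex_of_real (1 / sqrt (real N)) = 1 / of_nat N"
      by (simp flip: of_real_mult)
    then show ?thesis
      using that by (simp add: eigvec_index z_def power_mult_distrib power_mult[symmetric] mult_ac)
  qed
  ultimately show ?thesis
    using assms by (auto simp flip: sum_divide_distrib)
qed

text \<open>The matrix of the \<open>v_j\<close> is symmetric, so completeness is orthonormality
  with the two indices exchanged.\<close>

lemma eigvec_complete:
  assumes "r < N" "c < N"
  shows "(\<Sum>j<N. eigvec N j $ r * cnj (eigvec N j $ c)) = (if r = c then 1 else 0)"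
  using eigvec_orthonormal[OF assms] assms by (simp add: eigvec_index_swap)

lemma eigproj_index: "r < N \<Longrightarrow> c < N \<Longrightarrow> eigproj N j $$ (r, c) = eigvec N j $ r * cnj (eigvec N j $ c)"
  by (simp add: eigproj_def)

lemma eigproj_dim [simp]: "dim_row (eigproj N j) = N" "dim_col (eigproj N j) = N" "eigproj N j \<in> carrier_mat N N"
  by (simp_all add: eigproj_def)

text \<open>An entry of \<open>P_j P_k^*\<close> for the projections \<open>P_j = v_j v_j^*\<close>.
  This orthogonality removes the cross terms between modes from the covariances.\<close>

lemma eigproj_idempotent:
  assumes "r < N" "c < N" "j < N" "k < N"
  shows "(\<Sum>n<N. eigproj N j $$ (r, n) * cnj (eigproj N k $$ (c, n))) = (if j = k then eigproj N j $$ (r, c) else 0)"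
proof -
  have "(\<Sum>n<N. eigproj N j $$ (r, n) * cnj (eigproj N k $$ (c, n)))
      = eigvec N j $ r * cnj (eigvec N k $ c) * (\<Sum>n<N. eigvec N k $ n * cnj (eigvec N j $ n))"
    using assms by (simp add: eigproj_index sum_distrib_left mult_ac)
  then show ?thesis
    using assms by (simp add: eigvec_orthonormal eigproj_index)
qed

text \<open>|exp(i theta) - 1|^2 = 2 - 2 cos theta. It makes mu_j the eigenvalue of
  \<open>A^T A\<close> on mode j.\<close>

lemma \<kappa>_mult_cnj: "\<kappa> N j * cnj (\<kappa> N j) = complex_of_real (\<mu> N j)"
proof -
  define \<theta> where "\<theta> = 2 * pi * real j / real N"
  have "\<kappa> N j = cis \<theta> - 1"
    by (simp add: \<kappa>_def root_power cis_conv_exp mult_ac \<theta>_def)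
  moreover have "\<mu> N j = 2 - 2 * cos \<theta>"
    by (simp add: \<mu>_def \<theta>_def)
  moreover have "(cis \<theta> - 1) * cnj (cis \<theta> - 1) = complex_of_real (2 - 2 * cos \<theta>)"
    using sin_cos_squared_add[of \<theta>] by (simp add: complex_eq_iff power2_eq_square algebra_simps)
  ultimately show ?thesis by (simp only:)
qed

lemma \<kappa>_zero: "\<kappa> N 0 = 0" and \<mu>_zero: "\<mu> N 0 = 0"
  by (simp_all add: \<kappa>_def \<mu>_def)

lemma \<mu>_pos:
  assumes "j > 0" "j < N"
  shows "\<mu> N j > 0"
proof -
  have "\<kappa> N j \<noteq> 0"
    using assms root_power_inject[of j N 0] by (auto simp: \<kappa>_def)
  then have "complex_of_real (\<mu> N j) \<noteq> 0"
    unfolding \<kappa>_mult_cnj[symmetric] by simp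
  moreover have "\<mu> N j \<ge> 0" by (simp add: \<mu>_def)
  ultimately show ?thesis by simp
qed

text \<open>\<open>A\<close> is the cyclic shift minus the identity, so this is the eigenvector
  property behind kappa_j = omega^j - 1.\<close>

lemma eigvec_succ: "n < N \<Longrightarrow> eigvec N j $ (Suc n mod N) = root_\<omega> N ^ j * eigvec N j $ n"
  by (simp add: eigvec_index root_power_mod power_add)

text \<open>The coefficient \<open>v_j^* x\<close> in the unitary normalization;
  \<open>inverse_dft\<close> therefore carries no factor N.\<close>

definition dft :: "nat \<Rightarrow> nat \<Rightarrow> real vec \<Rightarrow> complex" where
  "dft N j x = (\<Sum>n<N. cnj (eigvec N j $ n) * complex_of_real (x $ n))"

lemma inverse_dft: "r < N \<Longrightarrow> (\<Sum>j<N. eigvec N j $ r * dft N j x) = complex_of_real (x $ r)"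
proof -
  assume r: "r < N"
  have "(\<Sum>j<N. eigvec N j $ r * dft N j x)
      = (\<Sum>n<N. (\<Sum>j<N. eigvec N j $ r * cnj (eigvec N j $ n)) * complex_of_real (x $ n))"
    unfolding dft_def sum_distrib_left sum_distrib_right by (subst sum.swap) (simp add: mult_ac)
  also have "\<dots> = (\<Sum>n<N. if r = n then complex_of_real (x $ n) else 0)"
    using r by (intro sum.cong refl) (simp add: eigvec_complete)
  finally show ?thesis using r by simp
qed

section \<open>Action of the circulant matrix on Fourier coefficients\<close>

lemma circ_A_dim [simp]: "circ_A N \<in> carrier_mat N N" "dim_row (circ_A N) = N" "dim_col (circ_A N) = N"
  by (simp_all add: circ_A_def)

lemma circ_A_row_sum:
  assumes "N \<ge> 2" "r < N"
  shows "(\<Sum>c<N. complex_of_real (circ_A N $$ (r, c)) * f c) = f (Suc r mod N) - f r"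
proof -
  \<comment> \<open>This is where N >= 2 enters: the entries -1 and 1 of a row lie in different
    columns.\<close>
  have neq: "Suc r mod N \<noteq> r" using assms by (auto simp: mod_Suc)
  have "(\<Sum>c<N. complex_of_real (circ_A N $$ (r, c)) * f c)
      = (\<Sum>c<N. (if c = Suc r mod N then f c else 0) - (if c = r then f c else 0))"
    using assms neq by (intro sum.cong refl) (auto simp: circ_A_def)
  then show ?thesis
    using assms by (simp add: sum_subtractf)
qed

text \<open>Column c has its entry 1 in the row of the cyclic predecessor of c. Evaluating f at the
  successor of the row index keeps predecessors out of the statement.\<close>

lemma circ_A_col_sum:
  assumes "N \<ge> 2" "c < N"
  shows "(\<Sum>r<N. complex_of_real (circ_A N $$ (r, c)) * f (Suc r mod N)) = f c - f (Suc c mod N)"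
proof -
  define c' where "c' = (if c = 0 then N - 1 else c - 1)"
  have c': "c' < N" "Suc c' mod N = c" "c' \<noteq> c" "\<And>r. r < N \<Longrightarrow> c = Suc r mod N \<longleftrightarrow> r = c'"
    using assms by (auto simp: c'_def mod_Suc)
  have "(\<Sum>r<N. complex_of_real (circ_A N $$ (r, c)) * f (Suc r mod N))
      = (\<Sum>r<N. (if r = c' then f (Suc r mod N) else 0) - (if r = c then f (Suc r mod N) else 0))"
    using assms c' by (intro sum.cong refl) (auto simp: circ_A_def)
  then show ?thesis
    using assms c' by (simp add: sum_subtractf)
qed

text \<open>\<open>v_j^*\<close> is also a left eigenvector of the circulant matrix: the cyclic
  shift is unitary, so it has the same eigenvectors from both sides.\<close>

lemma dft_circ_A:
  assumes "N \<ge> 2" "x \<in> carrier_vec N"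
  shows "dft N j (circ_A N *\<^sub>v x) = \<kappa> N j * dft N j x"
proof -
  \<comment> \<open>Written through the successor index, the conjugated eigenvector has the form
    that \<open>circ_A_col_sum\<close> expects.\<close>
  have eq: "root_\<omega> N ^ j * cnj (eigvec N j $ (Suc r mod N)) = cnj (eigvec N j $ r)" if "r < N" for r
    using root_mult_cnj[of N j] that by (simp add: eigvec_succ mult.assoc[symmetric])
  have "dft N j (circ_A N *\<^sub>v x)
      = (\<Sum>r<N. \<Sum>c<N. cnj (eigvec N j $ r) * complex_of_real (circ_A N $$ (r, c)) * complex_of_real (x $ c))"
    using assms by (simp add: dft_def scalar_prod_def sum_distrib_left atLeast0LessThan mult_ac)
  also have "\<dots> = (\<Sum>c<N. (\<Sum>r<N. complex_of_real (circ_A N $$ (r, c)) * (root_\<omega> N ^ j * cnj (eigvec N j $ (Suc r mod N)))) * complex_of_real (x $ c))"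
  proof -
    show ?thesis
      unfolding sum_distrib_right
      by (subst sum.swap) (intro sum.cong refl, simp only: eq lessThan_iff, simp only: mult_ac)
  qed
  also have "\<dots> = (\<Sum>c<N. \<kappa> N j * cnj (eigvec N j $ c) * complex_of_real (x $ c))"
  proof (intro sum.cong refl)
    fix c assume "c \<in> {..<N}"
    then show "(\<Sum>r<N. complex_of_real (circ_A N $$ (r, c)) * (root_\<omega> N ^ j * cnj (eigvec N j $ (Suc r mod N)))) * complex_of_real (x $ c)
      = \<kappa> N j * cnj (eigvec N j $ c) * complex_of_real (x $ c)"
      using assms(1) by (subst circ_A_col_sum) (simp_all add: eq \<kappa>_def algebra_simps)
  qed
  finally show ?thesis by (simp add: dft_def sum_distrib_left mult.assoc)
qed

lemma dft_circ_A_transpose: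
  assumes "N \<ge> 2" "x \<in> carrier_vec N"
  shows "dft N j (transpose_mat (circ_A N) *\<^sub>v x) = cnj (\<kappa> N j) * dft N j x"
proof -
  have "dft N j (transpose_mat (circ_A N) *\<^sub>v x)
      = (\<Sum>r<N. \<Sum>c<N. cnj (eigvec N j $ r) * complex_of_real (circ_A N $$ (c, r)) * complex_of_real (x $ c))"
    using assms by (simp add: dft_def scalar_prod_def sum_distrib_left atLeast0LessThan mult_ac)
  also have "\<dots> = (\<Sum>c<N. (\<Sum>r<N. complex_of_real (circ_A N $$ (c, r)) * cnj (eigvec N j $ r)) * complex_of_real (x $ c))"
    unfolding sum_distrib_right by (subst sum.swap) (simp add: mult_ac)
  also have "\<dots> = (\<Sum>c<N. cnj (\<kappa> N j) * cnj (eigvec N j $ c) * complex_of_real (x $ c))"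
    using assms(1)
    by (intro sum.cong refl, subst circ_A_row_sum) (simp_all add: eigvec_succ \<kappa>_def algebra_simps)
  finally show ?thesis by (simp add: dft_def sum_distrib_left mult.assoc)
qed

section \<open>Pathwise solution of the modes\<close>

lemma has_vector_derivative_reflect:
  assumes "(f has_vector_derivative f') (at (t - s))"
  shows "((\<lambda>s. f (t - s)) has_vector_derivative - f') (at s within S)"
proof -
  have "((\<lambda>s. t - s) has_vector_derivative -1) (at s within S)"
    by (auto intro!: derivative_eq_intros)
  from vector_diff_chain_within[OF this has_vector_derivative_at_within[OF assms]]
  show ?thesis by (simp add: o_def)
qed

text \<open>
  \<open>Q\<close> and \<open>C\<close> in the proof are \<open>q\<close> and \<open>p - \<sigma> \<omega>\<close>: these are differentiable although \<open>p\<close> is not.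
\<close>

lemma variation_of_constants:
  fixes q p \<omega> a b b' :: "real \<Rightarrow> complex" and k m1 m2 \<sigma> q0 p0 :: complex
  assumes t: "t \<ge> 0"
    and cont: "continuous_on {0..t} q" "continuous_on {0..t} p" "continuous_on {0..t} \<omega>"
    and q: "\<And>s. s \<in> {0..t} \<Longrightarrow> q s = q0 + k * integral {0..s} p"
    and p: "\<And>s. s \<in> {0..t} \<Longrightarrow> p s = p0 + integral {0..s} (\<lambda>u. - m1 * q u - m2 * p u) + \<sigma> * \<omega> s"
    and a: "\<And>s. (a has_vector_derivative - m1 * b s) (at s)"
    and b: "\<And>s. (b has_vector_derivative b' s) (at s)"
    and b': "\<And>s. b' s = k * a s - m2 * b s"
  shows "a 0 * q t + b 0 * p t
    = a t * q0 + b t * p0 + \<sigma> * (b 0 * \<omega> t + integral {0..t} (\<lambda>s. b' (t - s) * \<omega> s))"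
proof -
  define C where "C s = p0 + integral {0..s} (\<lambda>u. - m1 * q u - m2 * p u)" for s
  define Q where "Q s = q0 + k * integral {0..s} p" for s
  \<comment> \<open>h joins the initial data (s = 0) to the state at time t (s = t). Since (a, b)'
    equals (a, b) times the drift matrix, the drift cancels in h' and only the noise term
    remains.\<close>
  define h where "h s = a (t - s) * Q s + b (t - s) * C s" for s
  have "((\<lambda>s. \<sigma> * (b' (t - s) * \<omega> s)) has_integral (h t - h 0)) {0..t}"
  proof (rule fundamental_theorem_of_calculus[OF t])
    fix s assume s: "s \<in> {0..t}"
    have dQ: "(Q has_vector_derivative k * p s) (at s within {0..t})"
      unfolding Q_def[abs_def] using s cont
      by (auto intro!: derivative_eq_intros integral_has_vector_derivative)
    have "((\<lambda>s. integral {0..s} (\<lambda>u. - m1 * q u - m2 * p u)) has_vector_derivative - m1 * q s - m2 * p s) (at s within {0..t})"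
      using s cont by (intro integral_has_vector_derivative continuous_intros) auto
    then have dC: "(C has_vector_derivative - m1 * q s - m2 * p s) (at s within {0..t})"
      unfolding C_def[abs_def] by (auto intro!: derivative_eq_intros)
    have "(h has_vector_derivative
        (a (t - s) * (k * p s) + - (- m1 * b (t - s)) * Q s)
        + (b (t - s) * (- m1 * q s - m2 * p s) + - b' (t - s) * C s)) (at s within {0..t})"
      unfolding h_def[abs_def]
      by (intro has_vector_derivative_add has_vector_derivative_mult dQ dC has_vector_derivative_reflect[OF b] has_vector_derivative_reflect[OF a])
    moreover have "Q s = q s" "C s = p s - \<sigma> * \<omega> s"
      using q[OF s] p[OF s] by (simp_all add: Q_def C_def)
    ultimately show "(h has_vector_derivative \<sigma> * (b' (t - s) * \<omega> s)) (at s within {0..t})"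
      by (simp add: b' algebra_simps)
  qed
  then have "\<sigma> * integral {0..t} (\<lambda>s. b' (t - s) * \<omega> s) = h t - h 0"
    by (simp add: integral_unique flip: integral_mult_right)
  moreover have "h 0 = a t * q0 + b t * p0"
    by (simp add: h_def Q_def C_def)
  moreover have "h t = a 0 * q t + b 0 * (p t - \<sigma> * \<omega> t)"
    using q[of t] p[of t] t by (simp add: h_def Q_def C_def)
  ultimately show ?thesis
    by (simp add: algebra_simps)
qed

section \<open>Fourier coefficients of the integral equation\<close>

lemma dft_cong: "(\<And>n. n < N \<Longrightarrow> x $ n = y $ n) \<Longrightarrow> dft N j x = dft N j y"
  by (simp add: dft_def)

lemma dft_zero: "dft N j (0\<^sub>v N) = 0"
  by (simp add: dft_def)

lemma dft_add:
  assumes "x \<in> carrier_vec N" "y \<in> carrier_vec N"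
  shows "dft N j (x + y) = dft N j x + dft N j y"
  using assms by (simp add: dft_def distrib_left sum.distrib)

lemma dft_smult:
  assumes "x \<in> carrier_vec N"
  shows "dft N j (a \<cdot>\<^sub>v x) = complex_of_real a * dft N j x"
  using assms by (simp add: dft_def sum_distrib_left mult_ac)

lemma continuous_on_dft:
  assumes "\<And>n. n < N \<Longrightarrow> continuous_on S (\<lambda>s. x s $ n)"
  shows "continuous_on S (\<lambda>s. dft N j (x s))"
  unfolding dft_def using assms by (intro continuous_intros) auto

lemma dft_integral:
  fixes a b :: real
  assumes "\<And>n. n < N \<Longrightarrow> continuous_on {a..b} (\<lambda>s. x s $ n)"
  shows "dft N j (vec N (\<lambda>n. integral {a..b} (\<lambda>s. x s $ n))) = integral {a..b} (\<lambda>s. dft N j (x s))"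
proof -
  have "((\<lambda>s. dft N j (x s)) has_integral
      (\<Sum>n<N. cnj (eigvec N j $ n) * complex_of_real (integral {a..b} (\<lambda>s. x s $ n)))) {a..b}"
    unfolding dft_def
  proof (intro has_integral_sum has_integral_mult_right)
    fix n assume "n \<in> {..<N}"
    then have "((\<lambda>s. x s $ n) has_integral integral {a..b} (\<lambda>s. x s $ n)) {a..b}"
      by (intro integrable_integral integrable_continuous_real assms) auto
    from has_integral_linear[OF this bounded_linear_of_real]
    show "((\<lambda>s. complex_of_real (x s $ n)) has_integral complex_of_real (integral {a..b} (\<lambda>s. x s $ n))) {a..b}"
      by (simp add: o_def)
  qed auto
  then show ?thesis by (simp add: integral_unique dft_def)
qed

lemma zero_mat_mult_vec:
  "x \<in> carrier_vec n \<Longrightarrow> 0\<^sub>m m n *\<^sub>v x = 0\<^sub>v m"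
  by (auto simp: scalar_prod_def)

lemma smult_mat_mult_vec:
  "A \<in> carrier_mat m n \<Longrightarrow> x \<in> carrier_vec n \<Longrightarrow> (a \<cdot>\<^sub>m A) *\<^sub>v x = a \<cdot>\<^sub>v (A *\<^sub>v x)"
  for a :: "'a :: comm_semiring_0"
  by (auto simp: scalar_prod_def sum_distrib_left mult.assoc)

lemma drift_B_mult_vec:
  assumes "z \<in> carrier_vec (2 * N)"
  shows "drift_B N \<alpha> \<beta> *\<^sub>v z = (circ_A N *\<^sub>v vec_last z N) @\<^sub>v
    ((- (\<alpha>\<^sup>2)) \<cdot>\<^sub>v (transpose_mat (circ_A N) *\<^sub>v vec_first z N)
      + (- \<beta>) \<cdot>\<^sub>v (transpose_mat (circ_A N) *\<^sub>v (circ_A N *\<^sub>v vec_last z N)))"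
proof -
  let ?A = "circ_A N"
  have c: "vec_first z N \<in> carrier_vec N" "vec_last z N \<in> carrier_vec N"
    by simp_all
  have z: "z = vec_first z N @\<^sub>v vec_last z N"
    using assms by (subst vec_first_last_append) (simp_all add: mult_2)
  have "drift_B N \<alpha> \<beta> *\<^sub>v (vec_first z N @\<^sub>v vec_last z N)
      = (0\<^sub>m N N *\<^sub>v vec_first z N + ?A *\<^sub>v vec_last z N) @\<^sub>v
        (- (\<alpha>\<^sup>2) \<cdot>\<^sub>m transpose_mat ?A *\<^sub>v vec_first z N + - \<beta> \<cdot>\<^sub>m (transpose_mat ?A * ?A) *\<^sub>v vec_last z N)"
    unfolding drift_B_def by (rule four_block_mat_mult_vec[of _ N N _ N _ N]) auto
  also have "0\<^sub>m N N *\<^sub>v vec_first z N + ?A *\<^sub>v vec_last z N = ?A *\<^sub>v vec_last z N"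
    by (simp add: zero_mat_mult_vec[OF c(1)] left_zero_vec[OF carrier_vecI])
  also have "- (\<alpha>\<^sup>2) \<cdot>\<^sub>m transpose_mat ?A *\<^sub>v vec_first z N = (- (\<alpha>\<^sup>2)) \<cdot>\<^sub>v (transpose_mat ?A *\<^sub>v vec_first z N)"
    by (rule smult_mat_mult_vec[of _ N N]) auto
  also have "- \<beta> \<cdot>\<^sub>m (transpose_mat ?A * ?A) *\<^sub>v vec_last z N = (- \<beta>) \<cdot>\<^sub>v (transpose_mat ?A * ?A *\<^sub>v vec_last z N)"
    by (rule smult_mat_mult_vec[of _ N N]) auto
  also have "transpose_mat ?A * ?A *\<^sub>v vec_last z N = transpose_mat ?A *\<^sub>v (?A *\<^sub>v vec_last z N)"
    by (rule assoc_mult_mat_vec[of _ N N _ N]) auto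
  finally show ?thesis using z by simp
qed

lemma diffusion_G_mult_vec:
  assumes "w \<in> carrier_vec N"
  shows "diffusion_G N \<sigma> *\<^sub>v w = 0\<^sub>v N @\<^sub>v (\<sigma> \<cdot>\<^sub>v w)"
proof -
  have "diffusion_G N \<sigma> *\<^sub>v w = (0\<^sub>m N N *\<^sub>v w) @\<^sub>v (\<sigma> \<cdot>\<^sub>m 1\<^sub>m N *\<^sub>v w)"
    unfolding diffusion_G_def by (rule mat_mult_append[of _ N N _ N]) (use assms in auto)
  also have "\<sigma> \<cdot>\<^sub>m 1\<^sub>m N *\<^sub>v w = \<sigma> \<cdot>\<^sub>v (1\<^sub>m N *\<^sub>v w)"
    by (rule smult_mat_mult_vec[of _ N N]) (use assms in auto)
  finally show ?thesis using assms by (simp add: zero_mat_mult_vec[OF assms])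
qed

text \<open>For one fixed path, applying \<open>v_j^*\<close> to both block rows decouples the
  equation: it commutes with the time integral and replaces \<open>A\<close>, \<open>A^T\<close>,
  \<open>A^T A\<close> by kappa_j, its conjugate and mu_j.\<close>

lemma sde_modes:
  fixes z w :: "real \<Rightarrow> real vec"
  assumes N: "N \<ge> 2" and Q0: "Q0 \<in> carrier_vec N" and p0: "p0 \<in> carrier_vec N"
    and z_dim: "\<And>s. s \<ge> 0 \<Longrightarrow> z s \<in> carrier_vec (2 * N)" and w_dim: "\<And>s. s \<ge> 0 \<Longrightarrow> w s \<in> carrier_vec N"
    and z_cont: "\<And>i. i < 2 * N \<Longrightarrow> continuous_on {0..} (\<lambda>s. z s $ i)"
    and eqn: "\<And>s. s \<ge> 0 \<Longrightarrow> z s = (Q0 @\<^sub>v p0)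
      + vec (2 * N) (\<lambda>i. integral {0..s} (\<lambda>u. (drift_B N \<alpha> \<beta> *\<^sub>v z u) $ i)) + diffusion_G N \<sigma> *\<^sub>v w s"
    and s: "s \<ge> 0"
  shows "dft N j (vec_first (z s) N) = dft N j Q0 + \<kappa> N j * integral {0..s} (\<lambda>u. dft N j (vec_last (z u) N))"
    and "dft N j (vec_last (z s) N) = dft N j p0
      + integral {0..s} (\<lambda>u. - (complex_of_real (\<alpha>\<^sup>2) * cnj (\<kappa> N j)) * dft N j (vec_first (z u) N)
          - complex_of_real (\<beta> * \<mu> N j) * dft N j (vec_last (z u) N))
      + complex_of_real \<sigma> * dft N j (w s)"
proof -
  let ?A = "circ_A N"
  have fst: "vec_first (z u) N $ n = z u $ n" and lst: "vec_last (z u) N $ n = z u $ (N + n)"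
    if "u \<ge> 0" "n < N" for u n
    using z_dim[OF that(1)] that(2) by (auto simp: vec_first_def vec_last_def)
  have cont: "continuous_on {0..s} (\<lambda>u. vec_first (z u) N $ n)" "continuous_on {0..s} (\<lambda>u. vec_last (z u) N $ n)"
    if "n < N" for n
  proof -
    have c: "continuous_on {0..s} (\<lambda>u. z u $ n)" "continuous_on {0..s} (\<lambda>u. z u $ (N + n))"
      using that by (auto intro: continuous_on_subset[OF z_cont])
    show "continuous_on {0..s} (\<lambda>u. vec_first (z u) N $ n)"
      by (rule continuous_on_eq[OF c(1)]) (use that in \<open>simp add: fst\<close>)
    show "continuous_on {0..s} (\<lambda>u. vec_last (z u) N $ n)"
      by (rule continuous_on_eq[OF c(2)]) (use that in \<open>simp add: lst\<close>)
  qed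
  define F1 where "F1 u = ?A *\<^sub>v vec_last (z u) N" for u
  define F2 where "F2 u = (- (\<alpha>\<^sup>2)) \<cdot>\<^sub>v (transpose_mat ?A *\<^sub>v vec_first (z u) N)
      + (- \<beta>) \<cdot>\<^sub>v (transpose_mat ?A *\<^sub>v (?A *\<^sub>v vec_last (z u) N))" for u
  have Fc: "F1 u \<in> carrier_vec N" "F2 u \<in> carrier_vec N" for u
    by (rule carrier_vecI, simp add: F1_def F2_def)+
  have B: "drift_B N \<alpha> \<beta> *\<^sub>v z u = F1 u @\<^sub>v F2 u" if "u \<ge> 0" for u
    unfolding F1_def F2_def by (rule drift_B_mult_vec[OF z_dim[OF that]])
  have F_cont: "continuous_on {0..s} (\<lambda>u. F1 u $ n)" "continuous_on {0..s} (\<lambda>u. F2 u $ n)" if "n < N" for n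
    using that unfolding F1_def F2_def
    by (auto simp: scalar_prod_def intro!: continuous_intros cont)
  have eq1: "vec_first (z s) N $ n = (Q0 + vec N (\<lambda>n. integral {0..s} (\<lambda>u. F1 u $ n))) $ n" if "n < N" for n
  proof -
    have "integral {0..s} (\<lambda>u. (drift_B N \<alpha> \<beta> *\<^sub>v z u) $ n) = integral {0..s} (\<lambda>u. F1 u $ n)"
      by (rule integral_cong) (use that Fc in \<open>simp add: B carrier_vecD[OF Fc(1)]\<close>)
    then show ?thesis
      using that Q0 p0 w_dim[OF s]
      unfolding fst[OF s that] by (subst eqn[OF s]) (simp add: diffusion_G_mult_vec)
  qed
  have eq2: "vec_last (z s) N $ n = (p0 + vec N (\<lambda>n. integral {0..s} (\<lambda>u. F2 u $ n)) + \<sigma> \<cdot>\<^sub>v w s) $ n" if "n < N" for n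
  proof -
    have "integral {0..s} (\<lambda>u. (drift_B N \<alpha> \<beta> *\<^sub>v z u) $ (N + n)) = integral {0..s} (\<lambda>u. F2 u $ n)"
      by (rule integral_cong) (use that Fc in \<open>simp add: B carrier_vecD[OF Fc(1)] carrier_vecD[OF Fc(2)]\<close>)
    then show ?thesis
      using that Q0 p0 w_dim[OF s]
      unfolding lst[OF s that] by (subst eqn[OF s]) (simp add: diffusion_G_mult_vec)
  qed
  have dF1: "dft N j (F1 u) = \<kappa> N j * dft N j (vec_last (z u) N)" for u
    unfolding F1_def by (rule dft_circ_A[OF N]) simp
  have dF2: "dft N j (F2 u) = - (complex_of_real (\<alpha>\<^sup>2) * cnj (\<kappa> N j)) * dft N j (vec_first (z u) N)
          - complex_of_real (\<beta> * \<mu> N j) * dft N j (vec_last (z u) N)" for u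
  proof -
    have [simp]: "transpose_mat ?A *\<^sub>v x \<in> carrier_vec N" "?A *\<^sub>v x \<in> carrier_vec N" for x
      by (rule carrier_vecI, simp)+
    have "dft N j (F2 u) = - (complex_of_real (\<alpha>\<^sup>2) * cnj (\<kappa> N j)) * dft N j (vec_first (z u) N)
        - complex_of_real \<beta> * (cnj (\<kappa> N j) * (\<kappa> N j * dft N j (vec_last (z u) N)))"
      unfolding F2_def by (simp add: dft_add dft_smult dft_circ_A[OF N] dft_circ_A_transpose[OF N])
    also have "cnj (\<kappa> N j) * (\<kappa> N j * dft N j (vec_last (z u) N)) = complex_of_real (\<mu> N j) * dft N j (vec_last (z u) N)"
      unfolding \<kappa>_mult_cnj[symmetric] by (simp only: mult_ac)
    finally show ?thesis by simp
  qed
  have "dft N j (vec_first (z s) N) = dft N j Q0 + integral {0..s} (\<lambda>u. dft N j (F1 u))"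
    using Q0 F_cont(1) by (subst dft_cong[OF eq1]) (simp_all add: dft_add dft_integral)
  then show "dft N j (vec_first (z s) N) = dft N j Q0 + \<kappa> N j * integral {0..s} (\<lambda>u. dft N j (vec_last (z u) N))"
    by (simp add: dF1)
  have "dft N j (vec_last (z s) N) = dft N j p0 + integral {0..s} (\<lambda>u. dft N j (F2 u)) + complex_of_real \<sigma> * dft N j (w s)"
    using p0 F_cont(2) w_dim[OF s] by (subst dft_cong[OF eq2]) (simp_all add: dft_add dft_smult dft_integral)
  then show "dft N j (vec_last (z s) N) = dft N j p0
      + integral {0..s} (\<lambda>u. - (complex_of_real (\<alpha>\<^sup>2) * cnj (\<kappa> N j)) * dft N j (vec_first (z u) N)
          - complex_of_real (\<beta> * \<mu> N j) * dft N j (vec_last (z u) N))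
      + complex_of_real \<sigma> * dft N j (w s)"
    by (simp only: dF2)
qed

text \<open>
  \<open>(a, b)\<close> is a row vector function with \<open>(a, b)' = (a, b) B\<^sub>j\<close>, where \<open>B\<^sub>j\<close> is the \<open>2 \<times> 2\<close> drift matrix
  of mode \<open>j\<close>; multiples of the rows of \<open>exp (s B\<^sub>j)\<close> are the instances used.
\<close>

definition mode_kernel :: "nat \<Rightarrow> real \<Rightarrow> real \<Rightarrow> nat \<Rightarrow> (real \<Rightarrow> complex) \<Rightarrow> (real \<Rightarrow> complex) \<Rightarrow> bool" where
  "mode_kernel N \<alpha> \<beta> j a b \<longleftrightarrow>
     (\<forall>s. (a has_vector_derivative - (complex_of_real (\<alpha>\<^sup>2) * cnj (\<kappa> N j)) * b s) (at s)) \<and>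
     (\<forall>s. (b has_vector_derivative \<kappa> N j * a s - complex_of_real (\<beta> * \<mu> N j) * b s) (at s))"

lemma mode_kernel_continuous:
  assumes "mode_kernel N \<alpha> \<beta> j a b"
  shows "continuous_on S a" "continuous_on S b"
  using assms unfolding mode_kernel_def
  by (auto intro!: continuous_at_imp_continuous_on has_vector_derivative_continuous)

lemma mode_kernel_reflect_continuous:
  assumes "mode_kernel N \<alpha> \<beta> j a b"
  shows "continuous_on S (\<lambda>s. a (t - s))" "continuous_on S (\<lambda>s. b (t - s))"
  by (rule continuous_on_compose2[OF mode_kernel_continuous(1)[OF assms, of UNIV]]
      continuous_on_compose2[OF mode_kernel_continuous(2)[OF assms, of UNIV]]; auto intro!: continuous_intros)+

text \<open>The noise term of \<open>variation_of_constants\<close> is the partially integrated form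
  of the Wiener integral of b(t - s), hence a limit of Stieltjes sums.\<close>

lemma mode_stochastic_integral:
  fixes q p \<omega> a b :: "real \<Rightarrow> complex"
  assumes t: "t \<ge> 0"
    and cont: "continuous_on {0..t} q" "continuous_on {0..t} p" "continuous_on {0..t} \<omega>" and "\<omega> 0 = 0"
    and q: "\<And>s. s \<in> {0..t} \<Longrightarrow> q s = q0 + \<kappa> N j * integral {0..s} p"
    and p: "\<And>s. s \<in> {0..t} \<Longrightarrow> p s = p0 + integral {0..s} (\<lambda>u. - (complex_of_real (\<alpha>\<^sup>2) * cnj (\<kappa> N j)) * q u
          - complex_of_real (\<beta> * \<mu> N j) * p u) + \<sigma> * \<omega> s"
    and ker: "mode_kernel N \<alpha> \<beta> j a b"
  shows "(\<lambda>m. \<sigma> * (\<Sum>k<m. b (t - real k * t / real m) * (\<omega> (real (Suc k) * t / real m) - \<omega> (real k * t / real m))))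
    \<longlonglongrightarrow> a 0 * q t + b 0 * p t - (a t * q0 + b t * p0)"
proof -
  define b' where "b' s = \<kappa> N j * a s - complex_of_real (\<beta> * \<mu> N j) * b s" for s
  have a: "(a has_vector_derivative - (complex_of_real (\<alpha>\<^sup>2) * cnj (\<kappa> N j)) * b s) (at s)"
    and b: "(b has_vector_derivative b' s) (at s)" for s
    using ker by (auto simp: mode_kernel_def b'_def)
  have voc: "a 0 * q t + b 0 * p t = a t * q0 + b t * p0 + \<sigma> * (b 0 * \<omega> t + integral {0..t} (\<lambda>s. b' (t - s) * \<omega> s))"
    using variation_of_constants[OF t cont q p a b b'_def] .
  have "((\<lambda>s. b (t - s)) has_vector_derivative - b' (t - s)) (at s within {0..t})" for s
    by (rule has_vector_derivative_reflect[OF b])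
  moreover have "continuous_on {0..t} (\<lambda>s. - b' (t - s))"
    unfolding b'_def by (intro continuous_intros mode_kernel_reflect_continuous[OF ker])
  ultimately have "(\<lambda>m. \<Sum>k<m. b (t - real k * t / real m) * (\<omega> (real (Suc k) * t / real m) - \<omega> (real k * t / real m)))
      \<longlonglongrightarrow> b (t - t) * \<omega> t - integral {0..t} (\<lambda>s. - b' (t - s) * \<omega> s)"
    using t cont(3) \<open>\<omega> 0 = 0\<close> by (intro riemann_stieltjes_sum_tendsto) auto
  then have "(\<lambda>m. \<sigma> * (\<Sum>k<m. b (t - real k * t / real m) * (\<omega> (real (Suc k) * t / real m) - \<omega> (real k * t / real m))))
      \<longlonglongrightarrow> \<sigma> * (b 0 * \<omega> t + integral {0..t} (\<lambda>s. b' (t - s) * \<omega> s))"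
    unfolding mult_minus_left integral_neg by (intro tendsto_mult tendsto_const) simp
  then show ?thesis unfolding voc by simp
qed

section \<open>Impulse response and transient coefficients\<close>

lemma eigval_sum: "eigval N \<alpha> \<beta> j 1 + eigval N \<alpha> \<beta> j 2 = - complex_of_real (\<beta> * \<mu> N j)"
  by (simp add: eigval_def field_simps)

lemma eigval_diff_squared:
  "(eigval N \<alpha> \<beta> j 2 - eigval N \<alpha> \<beta> j 1)\<^sup>2 = complex_of_real (\<beta>\<^sup>2 * (\<mu> N j)\<^sup>2 - 4 * \<alpha>\<^sup>2 * \<mu> N j)"
proof -
  have "eigval N \<alpha> \<beta> j 2 - eigval N \<alpha> \<beta> j 1 = csqrt (complex_of_real (\<beta>\<^sup>2 * (\<mu> N j)\<^sup>2 - 4 * \<alpha>\<^sup>2 * \<mu> N j))"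
    by (simp add: eigval_def field_simps)
  then show ?thesis by (simp only: power2_csqrt)
qed

text \<open>From 4 x y = (x + y)^2 - (y - x)^2. Together with \<open>eigval_sum\<close> it makes the
  eigenvalues the roots of l^2 + beta mu_j l + alpha^2 mu_j.\<close>

lemma eigval_prod: "eigval N \<alpha> \<beta> j 1 * eigval N \<alpha> \<beta> j 2 = complex_of_real (\<alpha>\<^sup>2 * \<mu> N j)"
proof -
  define x y where "x = eigval N \<alpha> \<beta> j 1" and "y = eigval N \<alpha> \<beta> j 2"
  have "4 * (x * y) = (x + y)\<^sup>2 - (y - x)\<^sup>2"
    by (simp add: power2_eq_square algebra_simps)
  also have "\<dots> = (- complex_of_real (\<beta> * \<mu> N j))\<^sup>2 - complex_of_real (\<beta>\<^sup>2 * (\<mu> N j)\<^sup>2 - 4 * \<alpha>\<^sup>2 * \<mu> N j)"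
    unfolding x_def y_def eigval_sum eigval_diff_squared ..
  also have "\<dots> = 4 * complex_of_real (\<alpha>\<^sup>2 * \<mu> N j)"
    by (simp add: power_mult_distrib)
  finally show ?thesis by (simp add: x_def y_def)
qed

text \<open>The eigenvalues are real for a nonnegative discriminant and a conjugate pair otherwise;
  expressions symmetric in them that commute with conjugation are therefore real.\<close>

lemma eigval_cnj:
  "cnj (eigval N \<alpha> \<beta> j 1) = eigval N \<alpha> \<beta> j 1 \<and> cnj (eigval N \<alpha> \<beta> j 2) = eigval N \<alpha> \<beta> j 2 \<or>
   cnj (eigval N \<alpha> \<beta> j 1) = eigval N \<alpha> \<beta> j 2 \<and> cnj (eigval N \<alpha> \<beta> j 2) = eigval N \<alpha> \<beta> j 1"
proof -
  define D where "D = \<beta>\<^sup>2 * (\<mu> N j)\<^sup>2 - 4 * \<alpha>\<^sup>2 * \<mu> N j"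
  have e: "eigval N \<alpha> \<beta> j 1 = (- complex_of_real (\<beta> * \<mu> N j) - csqrt (complex_of_real D)) / 2"
    "eigval N \<alpha> \<beta> j 2 = (- complex_of_real (\<beta> * \<mu> N j) + csqrt (complex_of_real D)) / 2"
    by (simp_all add: eigval_def D_def)
  show ?thesis
  proof (cases "D \<ge> 0")
    case True
    then show ?thesis unfolding e by (simp add: csqrt_of_real_nonneg)
  next
    case False
    then show ?thesis unfolding e by (simp add: csqrt_of_real_nonpos)
  qed
qed

text \<open>
  The function \<open>g\<^sub>j\<close> and its derivative. The case \<open>j = 0\<close> is separate because \<open>\<lambda>\<^sub>0\<^sub>,\<^sub>1 = \<lambda>\<^sub>0\<^sub>,\<^sub>2 = 0\<close> would
  make the quotient \<open>0 / 0 = 0\<close>.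
\<close>

definition mode_g :: "nat \<Rightarrow> real \<Rightarrow> real \<Rightarrow> nat \<Rightarrow> real \<Rightarrow> complex" where
  "mode_g N \<alpha> \<beta> j s =
     (if j = 0 then of_real s
      else (exp (of_real s * eigval N \<alpha> \<beta> j 2) - exp (of_real s * eigval N \<alpha> \<beta> j 1))
        / (eigval N \<alpha> \<beta> j 2 - eigval N \<alpha> \<beta> j 1))"

definition mode_dg :: "nat \<Rightarrow> real \<Rightarrow> real \<Rightarrow> nat \<Rightarrow> real \<Rightarrow> complex" where
  "mode_dg N \<alpha> \<beta> j s =
     (if j = 0 then 1
      else (eigval N \<alpha> \<beta> j 2 * exp (of_real s * eigval N \<alpha> \<beta> j 2)
          - eigval N \<alpha> \<beta> j 1 * exp (of_real s * eigval N \<alpha> \<beta> j 1))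
        / (eigval N \<alpha> \<beta> j 2 - eigval N \<alpha> \<beta> j 1))"

lemma exp_has_vector_derivative:
  "((\<lambda>s. exp (complex_of_real s * l)) has_vector_derivative l * exp (complex_of_real s * l)) (at s)"
proof -
  have "((\<lambda>z. exp (z * l)) has_field_derivative l * exp (of_real s * l)) (at (complex_of_real s))"
    by (auto intro!: derivative_eq_intros)
  from has_vector_derivative_real_field[OF this] show ?thesis .
qed

lemma mode_g_derivative: "(mode_g N \<alpha> \<beta> j has_vector_derivative mode_dg N \<alpha> \<beta> j s) (at s)"
proof (cases "j = 0")
  case True
  then show ?thesis
    by (auto simp: mode_g_def[abs_def] mode_dg_def intro!: derivative_eq_intros has_vector_derivative_of_real)
next
  case False
  then show ?thesis
    unfolding mode_g_def[abs_def] mode_dg_def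
    by (auto intro!: has_vector_derivative_divide has_vector_derivative_diff exp_has_vector_derivative)
qed

lemma mode_dg_derivative:
  assumes "j < N"
  shows "(mode_dg N \<alpha> \<beta> j has_vector_derivative
    - complex_of_real (\<beta> * \<mu> N j) * mode_dg N \<alpha> \<beta> j s - complex_of_real (\<alpha>\<^sup>2 * \<mu> N j) * mode_g N \<alpha> \<beta> j s) (at s)"
proof (cases "j = 0")
  case True
  then show ?thesis
    by (auto simp: mode_dg_def[abs_def] \<mu>_zero intro!: derivative_eq_intros)
next
  case False
  define x y where "x = eigval N \<alpha> \<beta> j 1" and "y = eigval N \<alpha> \<beta> j 2"
  have "((\<lambda>s. (y * exp (of_real s * y) - x * exp (of_real s * x)) / (y - x)) has_vector_derivative
      (y * (y * exp (of_real s * y)) - x * (x * exp (of_real s * x))) / (y - x)) (at s)"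
    by (intro has_vector_derivative_divide has_vector_derivative_diff has_vector_derivative_mult_right exp_has_vector_derivative)
  \<comment> \<open>Both roots satisfy l^2 = (x + y) l - x y.\<close>
  also have "(y * (y * exp (of_real s * y)) - x * (x * exp (of_real s * x))) / (y - x)
      = (x + y) * ((y * exp (of_real s * y) - x * exp (of_real s * x)) / (y - x))
        - x * y * ((exp (of_real s * y) - exp (of_real s * x)) / (y - x))"
    by (simp add: divide_inverse algebra_simps)
  also have "\<dots> = - complex_of_real (\<beta> * \<mu> N j) * mode_dg N \<alpha> \<beta> j s
      - complex_of_real (\<alpha>\<^sup>2 * \<mu> N j) * mode_g N \<alpha> \<beta> j s"
    using False unfolding x_def y_def eigval_sum eigval_prod mode_dg_def mode_g_def by simp
  also have "(\<lambda>s. (y * exp (of_real s * y) - x * exp (of_real s * x)) / (y - x)) = mode_dg N \<alpha> \<beta> j"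
    using False by (simp add: mode_dg_def[abs_def] x_def y_def)
  finally show ?thesis .
qed

text \<open>Exchanging the eigenvalues changes the sign of numerator and denominator, so both
  quotients are symmetric and \<open>eigval_cnj\<close> applies. In the covariance integrands
  conjugation then affects kappa_j only.\<close>

lemma mode_g_cnj: "cnj (mode_g N \<alpha> \<beta> j s) = mode_g N \<alpha> \<beta> j s"
  and mode_dg_cnj: "cnj (mode_dg N \<alpha> \<beta> j s) = mode_dg N \<alpha> \<beta> j s"
proof -
  define F G where "F u v = (exp (of_real s * v) - exp (of_real s * u)) / (v - u)"
    and "G u v = (v * exp (of_real s * v) - u * exp (of_real s * u)) / (v - u)" for u v :: complex
  have *: "F u v = F v u" "G u v = G v u" "cnj (F u v) = F (cnj u) (cnj v)" "cnj (G u v) = G (cnj u) (cnj v)" for u v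
  proof -
    have swap: "(a - b) / (c - d) = (b - a) / (d - c)" for a b c d :: complex
      by (metis minus_diff_eq minus_divide_divide)
    show "F u v = F v u" "G u v = G v u"
      unfolding F_def G_def by (rule swap)+
    show "cnj (F u v) = F (cnj u) (cnj v)" "cnj (G u v) = G (cnj u) (cnj v)"
      by (simp_all add: F_def G_def exp_cnj)
  qed
  have "cnj (F (eigval N \<alpha> \<beta> j 1) (eigval N \<alpha> \<beta> j 2)) = F (eigval N \<alpha> \<beta> j 1) (eigval N \<alpha> \<beta> j 2)
      \<and> cnj (G (eigval N \<alpha> \<beta> j 1) (eigval N \<alpha> \<beta> j 2)) = G (eigval N \<alpha> \<beta> j 1) (eigval N \<alpha> \<beta> j 2)"
    using eigval_cnj[of N \<alpha> \<beta> j] *(1,2)[of "eigval N \<alpha> \<beta> j 2" "eigval N \<alpha> \<beta> j 1"]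
    by (elim disjE conjE) (simp_all only: *(3,4) simp_thms)
  then show "cnj (mode_g N \<alpha> \<beta> j s) = mode_g N \<alpha> \<beta> j s" "cnj (mode_dg N \<alpha> \<beta> j s) = mode_dg N \<alpha> \<beta> j s"
    unfolding mode_g_def mode_dg_def F_def G_def by simp_all
qed

text \<open>The discriminant is mu_j (beta^2 mu_j - 4 alpha^2); its second factor is nonzero by
  \<open>nondeg\<close> and mu_j is positive.\<close>

lemma discriminant_nonzero:
  assumes j: "0 < j" "j < N" and nondeg: "\<beta>\<^sup>2 * (1 - cos (2 * pi * real j / real N)) \<noteq> 2 * \<alpha>\<^sup>2"
  shows "\<beta>\<^sup>2 * \<mu> N j - 4 * \<alpha>\<^sup>2 \<noteq> 0" "eigval N \<alpha> \<beta> j 2 - eigval N \<alpha> \<beta> j 1 \<noteq> 0"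
proof -
  show *: "\<beta>\<^sup>2 * \<mu> N j - 4 * \<alpha>\<^sup>2 \<noteq> 0"
    using nondeg by (auto simp: \<mu>_def algebra_simps)
  have "\<beta>\<^sup>2 * (\<mu> N j)\<^sup>2 - 4 * \<alpha>\<^sup>2 * \<mu> N j = \<mu> N j * (\<beta>\<^sup>2 * \<mu> N j - 4 * \<alpha>\<^sup>2)"
    by (simp add: power2_eq_square algebra_simps)
  also have "\<dots> \<noteq> 0" using * \<mu>_pos[OF j] by simp
  finally show "eigval N \<alpha> \<beta> j 2 - eigval N \<alpha> \<beta> j 1 \<noteq> 0"
    using eigval_diff_squared[of N \<alpha> \<beta> j] by (metis of_real_eq_0_iff power_zero_numeral)
qed

text \<open>The derivatives are the products of the noise kernels kappa_j g_j and g_j' with their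
  conjugates. In terms of the two exponentials everything reduces to x + y = - b m and x y = A
  m.\<close>

lemma coeff_derivatives:
  assumes j: "0 < j" "j < N" and ab: "\<alpha> > 0" "\<beta> > 0"
    and nondeg: "\<beta>\<^sup>2 * (1 - cos (2 * pi * real j / real N)) \<noteq> 2 * \<alpha>\<^sup>2"
  shows "(coeff_a N \<alpha> \<beta> j has_vector_derivative (\<kappa> N j * mode_g N \<alpha> \<beta> j s) * cnj (\<kappa> N j * mode_g N \<alpha> \<beta> j s)) (at s)"
    and "(coeff_b N \<alpha> \<beta> j has_vector_derivative mode_dg N \<alpha> \<beta> j s * cnj (\<kappa> N j * mode_g N \<alpha> \<beta> j s)) (at s)"
    and "(coeff_c N \<alpha> \<beta> j has_vector_derivative mode_dg N \<alpha> \<beta> j s * cnj (mode_dg N \<alpha> \<beta> j s)) (at s)"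
    and "coeff_a N \<alpha> \<beta> j 0 = - complex_of_real (1 / (2 * \<alpha>\<^sup>2 * \<beta> * \<mu> N j))"
    and "coeff_b N \<alpha> \<beta> j 0 = 0"
    and "coeff_c N \<alpha> \<beta> j 0 = - complex_of_real (1 / (2 * \<beta> * \<mu> N j))"
proof -
  define x y A b m where "x = eigval N \<alpha> \<beta> j 1" and "y = eigval N \<alpha> \<beta> j 2"
    and "A = complex_of_real (\<alpha>\<^sup>2)" and "b = complex_of_real \<beta>" and "m = complex_of_real (\<mu> N j)"
  define D where "D = (y - x)\<^sup>2"
  have nz: "y - x \<noteq> 0" "A \<noteq> 0" "b \<noteq> 0" "m \<noteq> 0" "D \<noteq> 0"
    using discriminant_nonzero[OF j nondeg] ab \<mu>_pos[OF j] by (auto simp: x_def y_def A_def b_def m_def D_def)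
  have sum: "x + y = - (b * m)" and prod: "x * y = A * m"
    using eigval_sum[of N \<alpha> \<beta> j] eigval_prod[of N \<alpha> \<beta> j] by (simp_all add: x_def y_def A_def b_def m_def)
  have D: "D = b\<^sup>2 * m\<^sup>2 - 4 * A * m"
    using eigval_diff_squared[of N \<alpha> \<beta> j] by (simp add: D_def x_def y_def A_def b_def m_def)
  define E where "E l = (\<lambda>s. exp (complex_of_real s * l))" for l
  have E2: "exp (2 * of_real s * l) = E (2 * l) s" for s l
    by (simp add: E_def mult_ac)
  have Em: "of_real (exp (- s * \<beta> * \<mu> N j)) = E (x + y) s" for s
    by (simp add: E_def sum b_def m_def exp_of_real[symmetric] mult_ac)
  have dE: "(E l has_vector_derivative l * E l s) (at s)" for l s
    unfolding E_def by (rule exp_has_vector_derivative)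
  have Emult: "E (2 * l) s = (E l s)\<^sup>2" "E (k + l) s = E k s * E l s" for k l s
    by (simp_all add: E_def exp_add[symmetric] power2_eq_square algebra_simps)
  have E4: "complex_of_real (4 * \<alpha>\<^sup>2 * exp (- s * \<beta> * \<mu> N j)) = 4 * A * E (x + y) s" for s
    unfolding Em[symmetric] A_def by simp
  note folds = x_def[symmetric] y_def[symmetric] b_def[symmetric] E2 E4 Em
  have den: "complex_of_real (2 * \<alpha>\<^sup>2 * \<beta> * \<mu> N j * (\<beta>\<^sup>2 * \<mu> N j - 4 * \<alpha>\<^sup>2)) = 2 * A * b * D"
    "complex_of_real (2 * \<beta> * \<mu> N j * (\<beta>\<^sup>2 * (\<mu> N j)\<^sup>2 - 4 * \<alpha>\<^sup>2 * \<mu> N j)) = 2 * b * m * D"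
    "complex_of_real (2 * \<beta> * (\<beta>\<^sup>2 * (\<mu> N j)\<^sup>2 - 4 * \<alpha>\<^sup>2 * \<mu> N j)) = 2 * b * D"
    by (simp_all add: D A_def b_def m_def power2_eq_square algebra_simps)
  have bm: "complex_of_real (\<beta> * \<mu> N j) = b * m"
    by (simp add: b_def m_def)
  have a_eq: "coeff_a N \<alpha> \<beta> j = (\<lambda>s. (b * x * E (2 * y) s + 4 * A * E (x + y) s + b * y * E (2 * x) s) / (2 * A * b * D))"
    unfolding coeff_a_def[abs_def] folds den ..
  have b_eq: "coeff_b N \<alpha> \<beta> j = (\<lambda>s. (b * m * (E (2 * y) s + E (2 * x) s) + 2 * (y + x) * E (x + y) s) * cnj (\<kappa> N j) / (2 * b * m * D))"
    unfolding coeff_b_def[abs_def] folds den bm ..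
  have c_eq: "coeff_c N \<alpha> \<beta> j = (\<lambda>s. (y * b * E (2 * y) s + 4 * A * E (x + y) s + x * b * E (2 * x) s) / (2 * b * D))"
    unfolding coeff_c_def[abs_def] folds den ..
  note d = has_vector_derivative_divide has_vector_derivative_add has_vector_derivative_mult_right
    has_vector_derivative_mult_left dE
  have g: "mode_g N \<alpha> \<beta> j s = (E y s - E x s) / (y - x)" "mode_dg N \<alpha> \<beta> j s = (y * E y s - x * E x s) / (y - x)" for s
    using j by (simp_all add: mode_g_def mode_dg_def E_def x_def y_def)
  have kk: "\<kappa> N j * cnj (\<kappa> N j) = m"
    by (simp add: m_def \<kappa>_mult_cnj)
  have "(coeff_a N \<alpha> \<beta> j has_vector_derivative
      (b * x * (2 * y * E (2 * y) s) + 4 * A * ((x + y) * E (x + y) s) + b * y * (2 * x * E (2 * x) s)) / (2 * A * b * D)) (at s)"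
    unfolding a_eq by (intro d)
  also have "b * x * (2 * y * E (2 * y) s) + 4 * A * ((x + y) * E (x + y) s) + b * y * (2 * x * E (2 * x) s)
      = 2 * b * (x * y) * ((E y s)\<^sup>2 + (E x s)\<^sup>2) + 4 * A * (x + y) * (E x s * E y s)"
    unfolding Emult by (simp add: algebra_simps)
  \<comment> \<open>Here 2 b x y = 2 A b m and 4 A (x + y) = - 4 A b m, which completes the
    square.\<close>
  also have "\<dots> = 2 * A * b * (m * (E y s - E x s)\<^sup>2)"
    unfolding sum prod by (simp add: power2_eq_square algebra_simps)
  also have "\<dots> / (2 * A * b * D) = m * ((E y s - E x s) / (y - x))\<^sup>2"
    using nz by (simp add: D_def power_divide)
  also have "\<dots> = (\<kappa> N j * mode_g N \<alpha> \<beta> j s) * cnj (\<kappa> N j * mode_g N \<alpha> \<beta> j s)"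
    unfolding complex_cnj_mult mode_g_cnj g(1)[symmetric] kk[symmetric] by (simp only: power2_eq_square mult_ac)
  finally show "(coeff_a N \<alpha> \<beta> j has_vector_derivative (\<kappa> N j * mode_g N \<alpha> \<beta> j s) * cnj (\<kappa> N j * mode_g N \<alpha> \<beta> j s)) (at s)" .
  have "(coeff_b N \<alpha> \<beta> j has_vector_derivative
      (b * m * (2 * y * E (2 * y) s + 2 * x * E (2 * x) s) + 2 * (y + x) * ((x + y) * E (x + y) s)) * cnj (\<kappa> N j) / (2 * b * m * D)) (at s)"
    unfolding b_eq by (intro d)
  also have "b * m * (2 * y * E (2 * y) s + 2 * x * E (2 * x) s) + 2 * (y + x) * ((x + y) * E (x + y) s)
      = 2 * b * m * ((y * E y s - x * E x s) * (E y s - E x s))"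
  proof -
    \<comment> \<open>Only one of the two factors x + y becomes - b m; the other one supplies the
      mixed term of the product.\<close>
    have *: "2 * (y + x) * e = - (2 * (b * m) * e)" for e
      by (simp add: sum add.commute[of y x])
    show ?thesis
      unfolding * Emult by (simp add: power2_eq_square algebra_simps)
  qed
  also have "2 * b * m * ((y * E y s - x * E x s) * (E y s - E x s)) * cnj (\<kappa> N j) / (2 * b * m * D)
      = (y * E y s - x * E x s) / (y - x) * ((E y s - E x s) / (y - x)) * cnj (\<kappa> N j)"
  proof -
    have "2 * b * m * (u * v) * w / (2 * b * m * D) = u / (y - x) * (v / (y - x)) * w" for u v w
    proof -
      have "2 * b * m * (u * v) * w / (2 * b * m * D) = ((2 * b * m) * (u * v * w)) / ((2 * b * m) * D)"
        by (simp only: mult.assoc)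
      also have "\<dots> = u * v * w / D"
        by (rule mult_divide_mult_cancel_left) (use nz in simp)
      also have "\<dots> = u / (y - x) * (v / (y - x)) * w"
        by (simp add: D_def power2_eq_square)
      finally show ?thesis .
    qed
    then show ?thesis .
  qed
  also have "\<dots> = mode_dg N \<alpha> \<beta> j s * cnj (\<kappa> N j * mode_g N \<alpha> \<beta> j s)"
    unfolding complex_cnj_mult mode_g_cnj g[symmetric] by (simp only: mult_ac)
  finally show "(coeff_b N \<alpha> \<beta> j has_vector_derivative mode_dg N \<alpha> \<beta> j s * cnj (\<kappa> N j * mode_g N \<alpha> \<beta> j s)) (at s)" .
  have "(coeff_c N \<alpha> \<beta> j has_vector_derivative
      (y * b * (2 * y * E (2 * y) s) + 4 * A * ((x + y) * E (x + y) s) + x * b * (2 * x * E (2 * x) s)) / (2 * b * D)) (at s)"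
    unfolding c_eq by (intro d)
  also have "y * b * (2 * y * E (2 * y) s) + 4 * A * ((x + y) * E (x + y) s) + x * b * (2 * x * E (2 * x) s)
      = 2 * b * (y * E y s - x * E x s)\<^sup>2"
  proof -
    \<comment> \<open>4 A (x + y) = - 4 b (A m) = - 4 b x y is the mixed term of the square.\<close>
    have *: "4 * A * ((x + y) * e) = - (4 * b * (x * y) * e)" for e
      by (simp add: sum prod)
    show ?thesis
      unfolding * Emult by (simp add: power2_eq_square algebra_simps)
  qed
  also have "2 * b * (y * E y s - x * E x s)\<^sup>2 / (2 * b * D) = ((y * E y s - x * E x s) / (y - x))\<^sup>2"
    using nz by (simp add: D_def power_divide)
  also have "\<dots> = mode_dg N \<alpha> \<beta> j s * cnj (mode_dg N \<alpha> \<beta> j s)"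
    unfolding mode_dg_cnj g(2)[symmetric] by (simp only: power2_eq_square)
  finally show "(coeff_c N \<alpha> \<beta> j has_vector_derivative mode_dg N \<alpha> \<beta> j s * cnj (mode_dg N \<alpha> \<beta> j s)) (at s)" .
  have E0: "E l 0 = 1" for l by (simp add: E_def)
  \<comment> \<open>c is the common numerator of a_j and c_j at time 0. It cancels against D,
    leaving only a multiple of 1 / m.\<close>
  define c where "c = b * (x + y) + 4 * A"
  have Dc: "D = - (c * m)"
    unfolding c_def sum D by (simp add: power2_eq_square algebra_simps)
  then have "c \<noteq> 0" using nz(5) by auto
  have init: "c / (k * D) = - (1 / (k * m))" for k
    unfolding Dc using \<open>c \<noteq> 0\<close> by simp
  have "coeff_a N \<alpha> \<beta> j 0 = c / (2 * A * b * D)"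
    unfolding a_eq E0 c_def by (simp add: algebra_simps)
  then show "coeff_a N \<alpha> \<beta> j 0 = - complex_of_real (1 / (2 * \<alpha>\<^sup>2 * \<beta> * \<mu> N j))"
    unfolding init by (simp add: A_def b_def m_def)
  have "b * m * (1 + 1) + 2 * (y + x) * 1 = 0"
    by (simp add: sum add.commute[of y x])
  then show "coeff_b N \<alpha> \<beta> j 0 = 0"
    unfolding b_eq E0 by (simp only: mult_zero_left div_0)
  have "coeff_c N \<alpha> \<beta> j 0 = c / (2 * b * D)"
    unfolding c_eq E0 c_def by (simp add: algebra_simps)
  then show "coeff_c N \<alpha> \<beta> j 0 = - complex_of_real (1 / (2 * \<beta> * \<mu> N j))"
    unfolding init by (simp add: b_def m_def)
qed

lemma integral_reflected_derivative:
  fixes F :: "real \<Rightarrow> complex"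
  assumes "t \<ge> 0" and F: "\<And>s. (F has_vector_derivative f s) (at s)"
  shows "integral {0..t} (\<lambda>s. f (t - s)) = F t - F 0"
proof -
  have "((\<lambda>s. f (t - s)) has_integral - F (t - t) - - F (t - 0)) {0..t}"
  proof (rule fundamental_theorem_of_calculus[OF assms(1), where f = "\<lambda>s. - F (t - s)"])
    show "((\<lambda>s. - F (t - s)) has_vector_derivative f (t - s)) (at s within {0..t})" for s
      using has_vector_derivative_minus[OF has_vector_derivative_reflect[OF F]] by simp
  qed
  then show ?thesis by (simp add: integral_unique)
qed

section \<open>Covariance of the coordinates\<close>

text \<open>
  The row of \<open>exp (s B\<^sub>j)\<close> that belongs to coordinate \<open>r\<close>: the first row for \<open>r < N\<close> (positions) and the
  second one otherwise (momenta). For \<open>X\<close> in place of \<open>Z\<close> (\<open>centered\<close>), the zero kernel takes the place of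
  the second row in mode \<open>0\<close>.
\<close>

definition row_a :: "nat \<Rightarrow> real \<Rightarrow> real \<Rightarrow> bool \<Rightarrow> nat \<Rightarrow> nat \<Rightarrow> real \<Rightarrow> complex" where
  "row_a N \<alpha> \<beta> centered r j s =
     (if r < N then mode_dg N \<alpha> \<beta> j s + complex_of_real (\<beta> * \<mu> N j) * mode_g N \<alpha> \<beta> j s
      else if centered \<and> j = 0 then 0
      else - (complex_of_real (\<alpha>\<^sup>2) * cnj (\<kappa> N j)) * mode_g N \<alpha> \<beta> j s)"

definition row_b :: "nat \<Rightarrow> real \<Rightarrow> real \<Rightarrow> bool \<Rightarrow> nat \<Rightarrow> nat \<Rightarrow> real \<Rightarrow> complex" where
  "row_b N \<alpha> \<beta> centered r j s =
     (if r < N then \<kappa> N j * mode_g N \<alpha> \<beta> j s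
      else if centered \<and> j = 0 then 0
      else mode_dg N \<alpha> \<beta> j s)"

text \<open>Both rows follow from the equation for g_j'' and mu_j = |kappa_j|^2. The zero row solves
  the linear system as well, so centering stays within the same scheme.\<close>

lemma mode_kernel_row:
  assumes "j < N"
  shows "mode_kernel N \<alpha> \<beta> j (row_a N \<alpha> \<beta> x r j) (row_b N \<alpha> \<beta> x r j)"
proof -
  note dg = mode_dg_derivative[OF assms, of \<alpha> \<beta>] and g = mode_g_derivative[of N \<alpha> \<beta> j]
  let ?m1 = "complex_of_real (\<alpha>\<^sup>2) * cnj (\<kappa> N j)" and ?m2 = "complex_of_real (\<beta> * \<mu> N j)"
  consider "r < N" | "\<not> r < N" "x \<and> j = 0" | "\<not> r < N" "\<not> (x \<and> j = 0)" by blast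
  then show ?thesis
  proof cases
    case 1
    have "((\<lambda>s. mode_dg N \<alpha> \<beta> j s + ?m2 * mode_g N \<alpha> \<beta> j s) has_vector_derivative
        (- ?m2 * mode_dg N \<alpha> \<beta> j s - complex_of_real (\<alpha>\<^sup>2 * \<mu> N j) * mode_g N \<alpha> \<beta> j s) + ?m2 * mode_dg N \<alpha> \<beta> j s) (at s)" for s
      by (intro has_vector_derivative_add has_vector_derivative_mult_right dg g)
    moreover have "(- ?m2 * mode_dg N \<alpha> \<beta> j s - complex_of_real (\<alpha>\<^sup>2 * \<mu> N j) * mode_g N \<alpha> \<beta> j s) + ?m2 * mode_dg N \<alpha> \<beta> j s
        = - ?m1 * (\<kappa> N j * mode_g N \<alpha> \<beta> j s)" for s
      unfolding of_real_mult[of "\<alpha>\<^sup>2"] \<kappa>_mult_cnj[symmetric] by (simp add: mult_ac)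
    ultimately have a: "((\<lambda>s. mode_dg N \<alpha> \<beta> j s + ?m2 * mode_g N \<alpha> \<beta> j s) has_vector_derivative
        - ?m1 * (\<kappa> N j * mode_g N \<alpha> \<beta> j s)) (at s)" for s
      by (simp only:)
    have "((\<lambda>s. \<kappa> N j * mode_g N \<alpha> \<beta> j s) has_vector_derivative \<kappa> N j * mode_dg N \<alpha> \<beta> j s) (at s)" for s
      by (intro has_vector_derivative_mult_right g)
    moreover have "\<kappa> N j * mode_dg N \<alpha> \<beta> j s
        = \<kappa> N j * (mode_dg N \<alpha> \<beta> j s + ?m2 * mode_g N \<alpha> \<beta> j s) - ?m2 * (\<kappa> N j * mode_g N \<alpha> \<beta> j s)" for s
      by (simp add: algebra_simps)
    ultimately have b: "((\<lambda>s. \<kappa> N j * mode_g N \<alpha> \<beta> j s) has_vector_derivative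
        \<kappa> N j * (mode_dg N \<alpha> \<beta> j s + ?m2 * mode_g N \<alpha> \<beta> j s) - ?m2 * (\<kappa> N j * mode_g N \<alpha> \<beta> j s)) (at s)" for s
      by (simp only:)
    show ?thesis
      using 1 a b unfolding mode_kernel_def row_a_def[abs_def] row_b_def[abs_def] by (simp only: if_True) blast
  next
    case 2
    then show ?thesis
      by (simp add: mode_kernel_def row_a_def[abs_def] row_b_def[abs_def])
  next
    case 3
    have "((\<lambda>s. - ?m1 * mode_g N \<alpha> \<beta> j s) has_vector_derivative - ?m1 * mode_dg N \<alpha> \<beta> j s) (at s)" for s
      by (intro has_vector_derivative_mult_right g)
    moreover have "- ?m2 * mode_dg N \<alpha> \<beta> j s - complex_of_real (\<alpha>\<^sup>2 * \<mu> N j) * mode_g N \<alpha> \<beta> j s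
        = \<kappa> N j * (- ?m1 * mode_g N \<alpha> \<beta> j s) - ?m2 * mode_dg N \<alpha> \<beta> j s" for s
      unfolding of_real_mult[of "\<alpha>\<^sup>2"] \<kappa>_mult_cnj[symmetric] by (simp add: mult_ac)
    ultimately show ?thesis
      using 3 dg unfolding mode_kernel_def row_a_def[abs_def] row_b_def[abs_def] by (simp only: if_False) blast
  qed
qed

text \<open>The flag selects between the coordinates of \<open>Z\<close> and those of
  \<open>X\<close>, so that both covariance matrices come from one computation.\<close>

definition row_val :: "nat \<Rightarrow> bool \<Rightarrow> real vec \<Rightarrow> real vec" where
  "row_val N centered z = (if centered then center_momenta N z else z)"

lemma center_momenta_index:
  assumes "z \<in> carrier_vec (2 * N)" "r < 2 * N"
  shows "center_momenta N z $ r = (if r < N then z $ r else z $ r - (\<Sum>n<N. z $ (N + n)) / real N)"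
proof (cases "r < N")
  case True
  then show ?thesis using assms by (simp add: center_momenta_def vec_first_def centering_M_def)
next
  case False
  define i where "i = r - N"
  have i: "i < N" "r = N + i" using False assms by (auto simp: i_def)
  have last: "vec_last z N $ n = z $ (N + n)" if "n < N" for n
    using assms that by (simp add: vec_last_def)
  have "center_momenta N z $ r = (centering_M N *\<^sub>v vec_last z N) $ i"
    using i by (simp add: center_momenta_def centering_M_def)
  also have "\<dots> = (\<Sum>n<N. ((if n = i then 1 else 0) - 1 / real N) * z $ (N + n))"
    using i by (auto simp: centering_M_def scalar_prod_def atLeast0LessThan last intro!: sum.cong)
  also have "\<dots> = (\<Sum>n<N. if n = i then z $ (N + n) else 0) - (\<Sum>n<N. z $ (N + n)) / real N"
    unfolding sum_divide_distrib sum_subtractf[symmetric]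
    by (intro sum.cong) (auto simp: left_diff_distrib)
  finally show ?thesis using i by simp
qed

text \<open>Since g_j(0) = 0 and g_j'(0) = 1, the kernels at time 0 are rows of the identity, and
  the sum over the modes is Fourier inversion.\<close>

lemma row_val_modes:
  assumes N: "N > 0" and z: "z \<in> carrier_vec (2 * N)" and r: "r < 2 * N"
    and nondeg: "\<And>j. 0 < j \<Longrightarrow> j < N \<Longrightarrow> eigval N \<alpha> \<beta> j 2 - eigval N \<alpha> \<beta> j 1 \<noteq> 0"
  shows "complex_of_real (row_val N x z $ r) = (\<Sum>j<N. eigvec N j $ (r mod N) *
    (row_a N \<alpha> \<beta> x r j 0 * dft N j (vec_first z N) + row_b N \<alpha> \<beta> x r j 0 * dft N j (vec_last z N)))"
proof -
  have g0: "mode_g N \<alpha> \<beta> j 0 = 0" and dg0: "j < N \<Longrightarrow> mode_dg N \<alpha> \<beta> j 0 = 1" for j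
    using nondeg[of j] by (auto simp: mode_g_def mode_dg_def)
  show ?thesis
  proof (cases "r < N")
    case True
    have "(\<Sum>j<N. eigvec N j $ (r mod N) *
        (row_a N \<alpha> \<beta> x r j 0 * dft N j (vec_first z N) + row_b N \<alpha> \<beta> x r j 0 * dft N j (vec_last z N)))
        = (\<Sum>j<N. eigvec N j $ r * dft N j (vec_first z N))"
      using True by (intro sum.cong) (simp_all add: row_a_def row_b_def g0 dg0)
    also have "\<dots> = complex_of_real (z $ r)"
      using True z by (simp add: inverse_dft vec_first_def)
    finally show ?thesis
      using True center_momenta_index[OF z r] by (simp add: row_val_def)
  next
    case False
    define i where "i = r - N"
    have i: "i < N" "r = N + i" "r mod N = i" using False r by (auto simp: i_def mod_if)
    have last: "vec_last z N $ n = z $ (N + n)" if "n < N" for n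
      using z that by (simp add: vec_last_def)
    have "(\<Sum>j<N. eigvec N j $ (r mod N) *
        (row_a N \<alpha> \<beta> x r j 0 * dft N j (vec_first z N) + row_b N \<alpha> \<beta> x r j 0 * dft N j (vec_last z N)))
        = (\<Sum>j<N. eigvec N j $ i * dft N j (vec_last z N) - (if j = 0 then if x then eigvec N 0 $ i * dft N 0 (vec_last z N) else 0 else 0))"
      using False by (intro sum.cong) (auto simp: row_a_def row_b_def g0 dg0 i)
    also have "\<dots> = complex_of_real (z $ r) - (if x then eigvec N 0 $ i * dft N 0 (vec_last z N) else 0)"
      using N i by (simp add: sum_subtractf inverse_dft last)
    \<comment> \<open>\<open>v_0\<close> has constant entries, so the projection onto it is the mean
      of the momenta, exactly what centering subtracts.\<close>
    also have "eigvec N 0 $ i * dft N 0 (vec_last z N) = complex_of_real ((\<Sum>n<N. z $ (N + n)) / real N)"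
    proof -
      have "complex_of_real (1 / sqrt (real N)) * complex_of_real (1 / sqrt (real N)) = complex_of_real (1 / real N)"
        by (simp flip: of_real_mult)
      then show ?thesis
        using i by (simp add: dft_def eigvec_index last sum_divide_distrib flip: sum_distrib_left)
    qed
    finally show ?thesis
      using False center_momenta_index[OF z r] by (simp add: row_val_def)
  qed
qed

section \<open>From pathwise limits to covariances\<close>

lemma row_val_measurable:
  assumes Z: "random_vector P (2 * N) Z" and r: "r < 2 * N"
  shows "(\<lambda>w. row_val N x (Z w) $ r) \<in> borel_measurable P"
proof -
  have [measurable]: "(\<lambda>w. Z w $ i) \<in> borel_measurable P" if "i < 2 * N" for i
    using Z that by (simp add: random_vector_def)
  have "(\<lambda>w. if x \<and> \<not> r < N then Z w $ r - (\<Sum>n<N. Z w $ (N + n)) / real N else Z w $ r) \<in> borel_measurable P"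
    using r by (cases "x \<and> \<not> r < N") (auto intro!: borel_measurable_diff borel_measurable_divide borel_measurable_sum)
  then show ?thesis
  proof (rule measurable_cong[THEN iffD2, rotated])
    fix w assume "w \<in> space P"
    then have "Z w \<in> carrier_vec (2 * N)" using Z by (simp add: random_vector_def)
    then show "row_val N x (Z w) $ r = (if x \<and> \<not> r < N then Z w $ r - (\<Sum>n<N. Z w $ (N + n)) / real N else Z w $ r)"
      using center_momenta_index[of "Z w" N r] r by (auto simp: row_val_def)
  qed
qed

text \<open>The limits have mean zero, which forces \<open>c1\<close> and \<open>c2\<close> to be
  the means of \<open>Y1\<close> and \<open>Y2\<close>; the isometry then is the covariance
  formula.\<close>

lemma covariance_from_kernels:
  fixes Y1 Y2 :: "'w \<Rightarrow> real"
  assumes bm: "std_brownian_motion P d W" and t: "t \<ge> 0"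
    and f: "\<And>i. i < d \<Longrightarrow> continuous_on {0..t} (f i)" and g: "\<And>i. i < d \<Longrightarrow> continuous_on {0..t} (g i)"
    and [measurable]: "Y1 \<in> borel_measurable P" "Y2 \<in> borel_measurable P"
    and Y1: "AE w in P. (\<lambda>m. increment_sum d t W m (\<lambda>k i. f i (real k * t / real m)) w) \<longlonglongrightarrow> complex_of_real (Y1 w) - c1"
    and Y2: "AE w in P. (\<lambda>m. increment_sum d t W m (\<lambda>k i. g i (real k * t / real m)) w) \<longlonglongrightarrow> complex_of_real (Y2 w) - c2"
  shows "complex_of_real (\<integral>w. (Y1 w - (\<integral>w'. Y1 w' \<partial>P)) * (Y2 w - (\<integral>w'. Y2 w' \<partial>P)) \<partial>P)
    = (\<Sum>i<d. integral {0..t} (\<lambda>s. f i s * cnj (g i s)))"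
proof -
  interpret prob_space P using bm by (simp add: std_brownian_motion_def)
  have mean: "complex_of_real (\<integral>w. Y w \<partial>P) = c"
    if "integrable P (\<lambda>w. complex_of_real (Y w) - c)" "(\<integral>w. complex_of_real (Y w) - c \<partial>P) = 0"
    for Y :: "'w \<Rightarrow> real" and c
  proof -
    have "integrable P (\<lambda>w. (complex_of_real (Y w) - c) + c)"
      using that(1) by (rule Bochner_Integration.integrable_add) simp
    then have "integrable P (\<lambda>w. complex_of_real (Y w))" by simp
    then have "(\<integral>w. complex_of_real (Y w) - c \<partial>P) = (\<integral>w. complex_of_real (Y w) \<partial>P) - c"
      by (simp add: prob_space)
    with that(2) show ?thesis by (simp add: integral_complex_of_real)
  qed
  have m: "(\<lambda>w. complex_of_real (Y1 w) - c1) \<in> borel_measurable P" "(\<lambda>w. complex_of_real (Y2 w) - c2) \<in> borel_measurable P"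
    by measurable
  have 1: "complex_of_real (\<integral>w. Y1 w \<partial>P) = c1"
    by (rule mean[OF wiener_isometry(1,2)[OF bm t f f m(1,1) Y1 Y1]])
  have 2: "complex_of_real (\<integral>w. Y2 w \<partial>P) = c2"
    by (rule mean[OF wiener_isometry(1,2)[OF bm t g g m(2,2) Y2 Y2]])
  have "(\<integral>w. (complex_of_real (Y1 w) - c1) * cnj (complex_of_real (Y2 w) - c2) \<partial>P)
      = (\<integral>w. complex_of_real ((Y1 w - (\<integral>w'. Y1 w' \<partial>P)) * (Y2 w - (\<integral>w'. Y2 w' \<partial>P))) \<partial>P)"
    by (simp flip: 1 2)
  then show ?thesis
    using wiener_isometry(3)[OF bm t f g m Y1 Y2] by (simp only: integral_complex_of_real)
qed

text \<open>Regroups the sums of all modes, driven by Fourier coefficients of \<open>W\<close>, into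
  one sum over the real components of \<open>W\<close>, the form in which the isometry is
  available.\<close>

lemma increment_sum_modes:
  assumes r: "r < N"
  shows "increment_sum N t W m (\<lambda>k i. \<sigma> * (\<Sum>j<N. eigproj N j $$ (r, i) * b j (t - real k * t / real m))) w
    = (\<Sum>j<N. eigvec N j $ r * (\<sigma> * (\<Sum>k<m. b j (t - real k * t / real m) *
        (dft N j (W (real (Suc k) * t / real m) w) - dft N j (W (real k * t / real m) w)))))"
proof -
  define T where "T j k i = eigvec N j $ r * (\<sigma> * (b j (t - real k * t / real m) *
      (cnj (eigvec N j $ i) * complex_of_real (increment t W m k i w))))" for j k i
  have dft: "dft N j (W (real (Suc k) * t / real m) w) - dft N j (W (real k * t / real m) w)
      = (\<Sum>i<N. cnj (eigvec N j $ i) * complex_of_real (increment t W m k i w))" for j k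
    by (simp add: dft_def increment_def right_diff_distrib sum_subtractf)
  have "increment_sum N t W m (\<lambda>k i. \<sigma> * (\<Sum>j<N. eigproj N j $$ (r, i) * b j (t - real k * t / real m))) w
      = (\<Sum>k<m. \<Sum>i<N. \<Sum>j<N. T j k i)"
    unfolding increment_sum_def sum_distrib_left sum_distrib_right
    by (intro sum.cong refl) (use r in \<open>simp add: eigproj_index T_def mult_ac\<close>)
  also have "\<dots> = (\<Sum>k<m. \<Sum>j<N. \<Sum>i<N. T j k i)"
    by (intro sum.cong refl sum.swap)
  also have "\<dots> = (\<Sum>j<N. \<Sum>k<m. \<Sum>i<N. T j k i)"
    by (rule sum.swap)
  finally show ?thesis
    unfolding dft T_def sum_distrib_left .
qed

text \<open>For almost every path the mode formulas hold simultaneously and are recombined into one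
  coordinate. Of \<open>c\<close> it matters only that it is deterministic.\<close>

lemma linear_sde_row_limit:
  assumes N: "N \<ge> 2" and bm: "std_brownian_motion P N W"
    and Q0: "Q0 \<in> carrier_vec N" and p0: "p0 \<in> carrier_vec N"
    and sde: "linear_sde_solution P W (drift_B N \<alpha> \<beta>) (diffusion_G N \<sigma>) (Q0 @\<^sub>v p0) Z"
    and nondeg: "\<And>j. 0 < j \<Longrightarrow> j < N \<Longrightarrow> eigval N \<alpha> \<beta> j 2 - eigval N \<alpha> \<beta> j 1 \<noteq> 0"
    and t: "t \<ge> 0" and r: "r < 2 * N"
  obtains c where "AE w in P. (\<lambda>m. increment_sum N t W m
      (\<lambda>k i. complex_of_real \<sigma> * (\<Sum>j<N. eigproj N j $$ (r mod N, i) * row_b N \<alpha> \<beta> x r j (t - real k * t / real m))) w)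
    \<longlonglongrightarrow> complex_of_real (row_val N x (Z t w) $ r) - c"
proof
  let ?a = "row_a N \<alpha> \<beta> x r" and ?b = "row_b N \<alpha> \<beta> x r"
  \<comment> \<open>The contribution of the initial data at time t, as in the equation without
    noise.\<close>
  let ?c = "\<Sum>j<N. eigvec N j $ (r mod N) * (?a j t * dft N j Q0 + ?b j t * dft N j p0)"
  have dim: "dim_vec (Q0 @\<^sub>v p0) = 2 * N" using Q0 p0 by simp
  have W_dim: "W s w \<in> carrier_vec N" if "s \<ge> 0" "w \<in> space P" for s w
    using bm that by (simp add: std_brownian_motion_def random_vector_def)
  have Z_dim: "Z s w \<in> carrier_vec (2 * N)" if "s \<ge> 0" "w \<in> space P" for s w
    using sde that unfolding linear_sde_solution_def dim by (simp add: random_vector_def)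
  have W_AE: "AE w in P. W 0 w = 0\<^sub>v N" "AE w in P. \<forall>i<N. continuous_on {0..} (\<lambda>s. W s w $ i)"
    using bm by (simp_all add: std_brownian_motion_def)
  have Z_AE: "AE w in P. (\<forall>i<2 * N. continuous_on {0..} (\<lambda>s. Z s w $ i)) \<and>
      (\<forall>s\<ge>0. Z s w = (Q0 @\<^sub>v p0) + vec (2 * N) (\<lambda>i. integral {0..s} (\<lambda>u. (drift_B N \<alpha> \<beta> *\<^sub>v Z u w) $ i))
        + diffusion_G N \<sigma> *\<^sub>v W s w)"
    using sde unfolding linear_sde_solution_def dim by simp
  show "AE w in P. (\<lambda>m. increment_sum N t W m
      (\<lambda>k i. complex_of_real \<sigma> * (\<Sum>j<N. eigproj N j $$ (r mod N, i) * ?b j (t - real k * t / real m))) w)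
    \<longlonglongrightarrow> complex_of_real (row_val N x (Z t w) $ r) - ?c"
    using W_AE Z_AE AE_space
  proof eventually_elim
    case (elim w)
    let ?q = "\<lambda>j s. dft N j (vec_first (Z s w) N)" and ?p = "\<lambda>j s. dft N j (vec_last (Z s w) N)"
      and ?w = "\<lambda>j s. dft N j (W s w)"
    have Zc: "continuous_on {0..t} (\<lambda>s. Z s w $ i)" if "i < 2 * N" for i
      using elim(3) that by (auto intro: continuous_on_subset)
    have qc: "continuous_on {0..t} (?q j)" for j
    proof (rule continuous_on_dft)
      fix n assume "n < N"
      then show "continuous_on {0..t} (\<lambda>s. vec_first (Z s w) N $ n)"
        by (intro continuous_on_eq[OF Zc[of n]]) (simp_all add: vec_first_def)
    qed
    have pc: "continuous_on {0..t} (?p j)" for j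
    proof (rule continuous_on_dft)
      fix n assume "n < N"
      then show "continuous_on {0..t} (\<lambda>s. vec_last (Z s w) N $ n)"
        by (intro continuous_on_eq[OF Zc[of "N + n"]]) (simp_all add: vec_last_def carrier_vecD[OF Z_dim[OF _ elim(4)]])
    qed
    have wc: "continuous_on {0..t} (?w j)" for j
      using elim(2) by (intro continuous_on_dft) (auto intro: continuous_on_subset)
    have w0: "?w j 0 = 0" for j
      by (simp add: elim(1) dft_zero)
    note modes = sde_modes[OF N Q0 p0, of "\<lambda>s. Z s w" "\<lambda>s. W s w" \<alpha> \<beta> \<sigma>, OF Z_dim[OF _ elim(4)] W_dim[OF _ elim(4)]]
    have lim: "(\<lambda>m. complex_of_real \<sigma> * (\<Sum>k<m. ?b j (t - real k * t / real m) *
          (?w j (real (Suc k) * t / real m) - ?w j (real k * t / real m))))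
        \<longlonglongrightarrow> ?a j 0 * ?q j t + ?b j 0 * ?p j t - (?a j t * dft N j Q0 + ?b j t * dft N j p0)" if "j < N" for j
      by (rule mode_stochastic_integral[OF t qc pc wc w0 modes(1) modes(2) mode_kernel_row[OF that]])
        (use elim(3) in auto)
    have "(\<lambda>m. \<Sum>j<N. eigvec N j $ (r mod N) * (complex_of_real \<sigma> * (\<Sum>k<m. ?b j (t - real k * t / real m) *
          (?w j (real (Suc k) * t / real m) - ?w j (real k * t / real m)))))
        \<longlonglongrightarrow> (\<Sum>j<N. eigvec N j $ (r mod N) * (?a j 0 * ?q j t + ?b j 0 * ?p j t - (?a j t * dft N j Q0 + ?b j t * dft N j p0)))"
      by (intro tendsto_sum tendsto_mult tendsto_const lim) simp
    also have "(\<Sum>j<N. eigvec N j $ (r mod N) * (?a j 0 * ?q j t + ?b j 0 * ?p j t - (?a j t * dft N j Q0 + ?b j t * dft N j p0)))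
        = complex_of_real (row_val N x (Z t w) $ r) - ?c"
      using N by (subst row_val_modes[OF _ Z_dim[OF t elim(4)] r nondeg]) (simp_all add: right_diff_distrib sum_subtractf)
    finally show ?case
      using N by (subst increment_sum_modes) simp_all
  qed
qed

text \<open>The isometry leaves a sum over the components i of products of two mode sums; summing
  over i first multiplies two projections, and only equal modes survive. Positions and momenta of
  one site share the index modulo N.\<close>

lemma row_covariance:
  assumes N: "N \<ge> 2" and bm: "std_brownian_motion P N W"
    and Q0: "Q0 \<in> carrier_vec N" and p0: "p0 \<in> carrier_vec N"
    and sde: "linear_sde_solution P W (drift_B N \<alpha> \<beta>) (diffusion_G N \<sigma>) (Q0 @\<^sub>v p0) Z"
    and nondeg: "\<And>j. 0 < j \<Longrightarrow> j < N \<Longrightarrow> eigval N \<alpha> \<beta> j 2 - eigval N \<alpha> \<beta> j 1 \<noteq> 0"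
    and t: "t \<ge> 0" and r: "r < 2 * N" and c: "c < 2 * N"
  shows "complex_of_real (covariance_matrix P (2 * N) (\<lambda>w. row_val N x (Z t w)) $$ (r, c))
    = complex_of_real (\<sigma>\<^sup>2) * (\<Sum>j<N. eigproj N j $$ (r mod N, c mod N)
        * integral {0..t} (\<lambda>s. row_b N \<alpha> \<beta> x r j (t - s) * cnj (row_b N \<alpha> \<beta> x c j (t - s))))"
proof -
  define f where "f r i s = complex_of_real \<sigma> * (\<Sum>j<N. eigproj N j $$ (r mod N, i) * row_b N \<alpha> \<beta> x r j (t - s))" for r i s
  obtain c1 where c1: "AE w in P. (\<lambda>m. increment_sum N t W m (\<lambda>k i. f r i (real k * t / real m)) w)
    \<longlonglongrightarrow> complex_of_real (row_val N x (Z t w) $ r) - c1"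
    unfolding f_def by (rule linear_sde_row_limit[OF N bm Q0 p0 sde nondeg t r])
  obtain c2 where c2: "AE w in P. (\<lambda>m. increment_sum N t W m (\<lambda>k i. f c i (real k * t / real m)) w)
    \<longlonglongrightarrow> complex_of_real (row_val N x (Z t w) $ c) - c2"
    unfolding f_def by (rule linear_sde_row_limit[OF N bm Q0 p0 sde nondeg t c])
  have b_cont: "continuous_on {0..t} (\<lambda>s. row_b N \<alpha> \<beta> x r j (t - s))" if "j < N" for r j
    by (rule mode_kernel_reflect_continuous(2)[OF mode_kernel_row[OF that]])
  have cont: "continuous_on {0..t} (f r i)" for r i
    unfolding f_def by (intro continuous_intros b_cont) auto
  have rv: "random_vector P (2 * N) (Z t)"
    using sde t Q0 p0 by (simp add: linear_sde_solution_def mult_2)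
  have "complex_of_real (covariance_matrix P (2 * N) (\<lambda>w. row_val N x (Z t w)) $$ (r, c))
      = (\<Sum>i<N. integral {0..t} (\<lambda>s. f r i s * cnj (f c i s)))"
    using covariance_from_kernels[OF bm t cont cont row_val_measurable[OF rv r] row_val_measurable[OF rv c] c1 c2] r c
    by (simp add: covariance_matrix_def)
  also have "\<dots> = integral {0..t} (\<lambda>s. \<Sum>i<N. f r i s * cnj (f c i s))"
    by (intro integral_sum[symmetric] integrable_continuous_real continuous_intros cont) auto
  also have "\<dots> = integral {0..t} (\<lambda>s. \<Sum>j<N. complex_of_real (\<sigma>\<^sup>2) * (eigproj N j $$ (r mod N, c mod N)
      * (row_b N \<alpha> \<beta> x r j (t - s) * cnj (row_b N \<alpha> \<beta> x c j (t - s)))))"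
  proof (rule integral_cong)
    fix s
    let ?u = "\<lambda>j. row_b N \<alpha> \<beta> x r j (t - s)" and ?v = "\<lambda>j. row_b N \<alpha> \<beta> x c j (t - s)"
    have "(\<Sum>i<N. f r i s * cnj (f c i s)) = (\<Sum>i<N. \<Sum>j<N. \<Sum>k<N.
        complex_of_real (\<sigma>\<^sup>2) * (?u j * cnj (?v k)) * (eigproj N j $$ (r mod N, i) * cnj (eigproj N k $$ (c mod N, i))))"
    proof (rule sum.cong[OF refl])
      fix i
      have "f r i s * cnj (f c i s) = complex_of_real (\<sigma>\<^sup>2) * ((\<Sum>j<N. eigproj N j $$ (r mod N, i) * ?u j)
          * (\<Sum>k<N. cnj (eigproj N k $$ (c mod N, i) * ?v k)))"
        unfolding f_def complex_cnj_mult cnj_sum by (simp add: power2_eq_square mult_ac)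
      then show "f r i s * cnj (f c i s) = (\<Sum>j<N. \<Sum>k<N.
          complex_of_real (\<sigma>\<^sup>2) * (?u j * cnj (?v k)) * (eigproj N j $$ (r mod N, i) * cnj (eigproj N k $$ (c mod N, i))))"
        unfolding sum_product unfolding sum_distrib_left by (simp add: mult_ac)
    qed
    also have "\<dots> = (\<Sum>j<N. \<Sum>i<N. \<Sum>k<N.
        complex_of_real (\<sigma>\<^sup>2) * (?u j * cnj (?v k)) * (eigproj N j $$ (r mod N, i) * cnj (eigproj N k $$ (c mod N, i))))"
      by (rule sum.swap)
    also have "\<dots> = (\<Sum>j<N. \<Sum>k<N. \<Sum>i<N.
        complex_of_real (\<sigma>\<^sup>2) * (?u j * cnj (?v k)) * (eigproj N j $$ (r mod N, i) * cnj (eigproj N k $$ (c mod N, i))))"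
      by (intro sum.cong refl sum.swap)
    also have "\<dots> = (\<Sum>j<N. \<Sum>k<N. if j = k then complex_of_real (\<sigma>\<^sup>2) * (?u j * cnj (?v j)) * eigproj N j $$ (r mod N, c mod N) else 0)"
      using N unfolding sum_distrib_left[symmetric] by (intro sum.cong refl) (simp add: eigproj_idempotent)
    also have "\<dots> = (\<Sum>j<N. complex_of_real (\<sigma>\<^sup>2) * (eigproj N j $$ (r mod N, c mod N) * (?u j * cnj (?v j))))"
      by (intro sum.cong refl) (simp add: mult_ac)
    finally show "(\<Sum>i<N. f r i s * cnj (f c i s))
      = (\<Sum>j<N. complex_of_real (\<sigma>\<^sup>2) * (eigproj N j $$ (r mod N, c mod N) * (?u j * cnj (?v j))))" .
  qed
  also have "\<dots> = (\<Sum>j<N. integral {0..t} (\<lambda>s. complex_of_real (\<sigma>\<^sup>2) * (eigproj N j $$ (r mod N, c mod N)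
      * (row_b N \<alpha> \<beta> x r j (t - s) * cnj (row_b N \<alpha> \<beta> x c j (t - s))))))"
    by (intro integral_sum integrable_continuous_real continuous_intros b_cont) auto
  finally show ?thesis
    by (simp add: sum_distrib_left)
qed

text \<open>By \<open>coeff_derivatives\<close> the integrands are reflected derivatives of a_j,
  b_j, its conjugate and c_j. The added constants are - a_j(0) and - c_j(0).\<close>

lemma row_integral:
  fixes x :: bool
  assumes j: "0 < j" "j < N" and ab: "\<alpha> > 0" "\<beta> > 0" and t: "t \<ge> 0"
    and nondeg: "\<beta>\<^sup>2 * (1 - cos (2 * pi * real j / real N)) \<noteq> 2 * \<alpha>\<^sup>2"
  shows "integral {0..t} (\<lambda>s. row_b N \<alpha> \<beta> x r j (t - s) * cnj (row_b N \<alpha> \<beta> x c j (t - s)))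
    = (if r < N then if c < N then coeff_a N \<alpha> \<beta> j t + complex_of_real (1 / (2 * \<alpha>\<^sup>2 * \<beta> * \<mu> N j)) else cnj (coeff_b N \<alpha> \<beta> j t)
       else if c < N then coeff_b N \<alpha> \<beta> j t else coeff_c N \<alpha> \<beta> j t + complex_of_real (1 / (2 * \<beta> * \<mu> N j)))"
proof -
  note D = coeff_derivatives[OF j ab nondeg]
  have cnj_b: "((\<lambda>s. cnj (coeff_b N \<alpha> \<beta> j s)) has_vector_derivative
      (\<kappa> N j * mode_g N \<alpha> \<beta> j s) * cnj (mode_dg N \<alpha> \<beta> j s)) (at s)" for s
    using bounded_linear.has_vector_derivative[OF bounded_linear_cnj D(2)[of s]] by (simp add: mult_ac)
  note I = integral_reflected_derivative[OF t D(1)] integral_reflected_derivative[OF t D(2)]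
    integral_reflected_derivative[OF t D(3)] integral_reflected_derivative[OF t cnj_b]
  show ?thesis
    using j(1) by (auto simp: row_b_def I D(4-6) simp del: complex_cnj_mult)
qed

text \<open>kappa_0 = 0 keeps the noise of mode 0 away from the positions, and g_0' = 1 makes the
  mean momentum a multiple of Brownian motion, with variance growing like t.\<close>

lemma row_integral_0:
  assumes "N > 0" "t \<ge> 0"
  shows "integral {0..t} (\<lambda>s. row_b N \<alpha> \<beta> x r 0 (t - s) * cnj (row_b N \<alpha> \<beta> x c 0 (t - s)))
    = (if r < N \<or> c < N \<or> x then 0 else complex_of_real t)"
  using assms
  by (cases x; cases "r < N"; cases "c < N"; simp add: row_b_def \<kappa>_zero mode_dg_def scaleR_conv_of_real)

section \<open>Assembly of the matrix identities\<close>

lemma matrix_K_index: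
  "r < N \<Longrightarrow> c < N \<Longrightarrow> matrix_K N $$ (r, c) = (\<Sum>j=1..N-1. complex_of_real (1 / \<mu> N j) * eigproj N j $$ (r, c))"
  by (simp add: matrix_K_def mat_sum_def)

lemma matrix_K_dim [simp]: "dim_row (matrix_K N) = N" "dim_col (matrix_K N) = N"
  by (simp_all add: matrix_K_def mat_sum_def)

lemma transient_sum_index:
  assumes "r < 2 * N" "c < 2 * N"
  shows "transient_sum N \<alpha> \<beta> t $$ (r, c) = (\<Sum>j=1..N-1.
    (if r < N then if c < N then coeff_a N \<alpha> \<beta> j t else cnj (coeff_b N \<alpha> \<beta> j t)
     else if c < N then coeff_b N \<alpha> \<beta> j t else coeff_c N \<alpha> \<beta> j t) * eigproj N j $$ (r mod N, c mod N))"
  using assms unfolding transient_sum_def mat_sum_def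
  by (auto simp: mod_if intro!: sum.cong)

lemma transient_sum_dim [simp]:
  "dim_row (transient_sum N \<alpha> \<beta> t) = 2 * N" "dim_col (transient_sum N \<alpha> \<beta> t) = 2 * N"
  by (simp_all add: transient_sum_def mat_sum_def)

text \<open>Mode 0 is split off and yields the term linear in t; the constants from
  \<open>row_integral\<close>, summed over the other modes, yield the multiples of K.\<close>

lemma row_covariance_explicit:
  assumes N: "N \<ge> 2" and ab: "\<alpha> > 0" "\<beta> > 0" and bm: "std_brownian_motion P N W"
    and Q0: "Q0 \<in> carrier_vec N" and p0: "p0 \<in> carrier_vec N"
    and sde: "linear_sde_solution P W (drift_B N \<alpha> \<beta>) (diffusion_G N \<sigma>) (Q0 @\<^sub>v p0) Z"
    and nondeg: "\<forall>j\<in>{1..N-1}. \<beta>\<^sup>2 * (1 - cos (2 * pi * real j / real N)) \<noteq> 2 * \<alpha>\<^sup>2"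
    and t: "t \<ge> 0"
  shows "map_mat complex_of_real (covariance_matrix P (2 * N) (\<lambda>w. row_val N x (Z t w))) =
      four_block_mat
        (complex_of_real (\<sigma>\<^sup>2 / (2 * \<alpha>\<^sup>2 * \<beta>)) \<cdot>\<^sub>m matrix_K N)
        (0\<^sub>m N N)
        (0\<^sub>m N N)
        (complex_of_real (if x then 0 else \<sigma>\<^sup>2 * t) \<cdot>\<^sub>m eigproj N 0
           + complex_of_real (\<sigma>\<^sup>2 / (2 * \<beta>)) \<cdot>\<^sub>m matrix_K N)
      + complex_of_real (\<sigma>\<^sup>2) \<cdot>\<^sub>m transient_sum N \<alpha> \<beta> t"
    (is "?L = ?R")
proof (rule eq_matI)
  show "dim_row ?L = dim_row ?R" "dim_col ?L = dim_col ?R"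
    by (simp_all add: covariance_matrix_def)
next
  fix r c assume "r < dim_row ?R" "c < dim_col ?R"
  then have rc: "r < 2 * N" "c < 2 * N" by simp_all
  have nondeg': "\<beta>\<^sup>2 * (1 - cos (2 * pi * real j / real N)) \<noteq> 2 * \<alpha>\<^sup>2" if "0 < j" "j < N" for j
    using nondeg that by auto
  let ?I = "\<lambda>j. integral {0..t} (\<lambda>s. row_b N \<alpha> \<beta> x r j (t - s) * cnj (row_b N \<alpha> \<beta> x c j (t - s)))"
    and ?E = "\<lambda>j. eigproj N j $$ (r mod N, c mod N)"
  have split: "{..<N} = insert 0 {1..N-1}" using N by auto
  have "?L $$ (r, c) = complex_of_real (\<sigma>\<^sup>2) * (\<Sum>j<N. ?E j * ?I j)"
    using row_covariance[OF N bm Q0 p0 sde discriminant_nonzero(2)[OF _ _ nondeg'] t rc, of x] rc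
    by (simp add: covariance_matrix_def)
  also have "\<dots> = complex_of_real (\<sigma>\<^sup>2) * (?E 0 * ?I 0) + complex_of_real (\<sigma>\<^sup>2) * (\<Sum>j=1..N-1. ?E j * ?I j)"
    unfolding split by (simp add: distrib_left)
  also have "\<dots> = ?R $$ (r, c)"
  proof -
    have idx: "r < N \<Longrightarrow> r mod N = r" "\<not> r < N \<Longrightarrow> r mod N = r - N" "c < N \<Longrightarrow> c mod N = c" "\<not> c < N \<Longrightarrow> c mod N = c - N"
      using rc by (auto simp: mod_if)
    have I: "?I j = (if r < N then if c < N then coeff_a N \<alpha> \<beta> j t + complex_of_real (1 / (2 * \<alpha>\<^sup>2 * \<beta> * \<mu> N j)) else cnj (coeff_b N \<alpha> \<beta> j t)
        else if c < N then coeff_b N \<alpha> \<beta> j t else coeff_c N \<alpha> \<beta> j t + complex_of_real (1 / (2 * \<beta> * \<mu> N j)))"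
      if "j \<in> {1..N-1}" for j
      by (rule row_integral[OF _ _ ab t nondeg']) (use that in auto)
    have I0: "?I 0 = (if r < N \<or> c < N \<or> x then 0 else complex_of_real t)"
      by (rule row_integral_0) (use N t in auto)
    have sum_eq: "(\<Sum>j=1..N-1. ?E j * ?I j) = (\<Sum>j=1..N-1. ?E j * (if r < N then if c < N then coeff_a N \<alpha> \<beta> j t + complex_of_real (1 / (2 * \<alpha>\<^sup>2 * \<beta> * \<mu> N j)) else cnj (coeff_b N \<alpha> \<beta> j t)
        else if c < N then coeff_b N \<alpha> \<beta> j t else coeff_c N \<alpha> \<beta> j t + complex_of_real (1 / (2 * \<beta> * \<mu> N j))))"
      by (intro sum.cong refl) (simp only: I)
    show ?thesis
      unfolding sum_eq I0 using rc
      by (cases "r < N"; cases "c < N")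
        (auto simp: transient_sum_index matrix_K_index idx sum_distrib_left sum.distrib algebra_simps)
  qed
  finally show "?L $$ (r, c) = ?R $$ (r, c)" .
qed

theorem proposition3p7:
  fixes N :: nat and L \<alpha> \<beta> \<sigma> :: real
    and P :: "'w measure"
    and W Z X :: "real \<Rightarrow> 'w \<Rightarrow> real vec"
    and Q0 p0 :: "real vec"
  assumes "N \<ge> 3" and "L > 0" and "\<alpha> > 0" and "\<beta> > 0"
    and "std_brownian_motion P N W"
    and "Q0 \<in> carrier_vec N" and "\<forall>n<N. Q0 $ n \<ge> 0" and "(\<Sum>n<N. Q0 $ n) = L"
    and "p0 \<in> carrier_vec N"
    and "linear_sde_solution P W (drift_B N \<alpha> \<beta>) (diffusion_G N \<sigma>) (Q0 @\<^sub>v p0) Z"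
    and "\<forall>t\<ge>0. \<forall>w\<in>space P. X t w = center_momenta N (Z t w)"
    and "\<forall>j\<in>{1..N-1}. \<beta>\<^sup>2 * (1 - cos (2 * pi * real j / real N)) \<noteq> 2 * \<alpha>\<^sup>2"
  shows "\<forall>t\<ge>0.
    map_mat complex_of_real (covariance_matrix P (2 * N) (Z t)) =
      four_block_mat
        (complex_of_real (\<sigma>\<^sup>2 / (2 * \<alpha>\<^sup>2 * \<beta>)) \<cdot>\<^sub>m matrix_K N)
        (0\<^sub>m N N)
        (0\<^sub>m N N)
        (complex_of_real (\<sigma>\<^sup>2 * t) \<cdot>\<^sub>m eigproj N 0
           + complex_of_real (\<sigma>\<^sup>2 / (2 * \<beta>)) \<cdot>\<^sub>m matrix_K N)
      + complex_of_real (\<sigma>\<^sup>2) \<cdot>\<^sub>m transient_sum N \<alpha> \<beta> t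
    \<and>
    map_mat complex_of_real (covariance_matrix P (2 * N) (X t)) =
      four_block_mat
        (complex_of_real (\<sigma>\<^sup>2 / (2 * \<alpha>\<^sup>2 * \<beta>)) \<cdot>\<^sub>m matrix_K N)
        (0\<^sub>m N N)
        (0\<^sub>m N N)
        (complex_of_real (\<sigma>\<^sup>2 / (2 * \<beta>)) \<cdot>\<^sub>m matrix_K N)
      + complex_of_real (\<sigma>\<^sup>2) \<cdot>\<^sub>m transient_sum N \<alpha> \<beta> t"
proof (intro allI impI conjI)
  fix t :: real assume t: "t \<ge> 0"
  have N: "N \<ge> 2" using assms(1) by simp
  note cov = row_covariance_explicit[OF N assms(3,4,5,6,9,10,12) t]
  show "map_mat complex_of_real (covariance_matrix P (2 * N) (Z t)) =
      four_block_mat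
        (complex_of_real (\<sigma>\<^sup>2 / (2 * \<alpha>\<^sup>2 * \<beta>)) \<cdot>\<^sub>m matrix_K N)
        (0\<^sub>m N N)
        (0\<^sub>m N N)
        (complex_of_real (\<sigma>\<^sup>2 * t) \<cdot>\<^sub>m eigproj N 0
           + complex_of_real (\<sigma>\<^sup>2 / (2 * \<beta>)) \<cdot>\<^sub>m matrix_K N)
      + complex_of_real (\<sigma>\<^sup>2) \<cdot>\<^sub>m transient_sum N \<alpha> \<beta> t"
    using cov[of False] by (simp add: row_val_def)
  \<comment> \<open>\<open>X\<close> is prescribed only on \<open>space P\<close>, so the two
    covariance matrices are compared through their integrals.\<close>
  have mean: "(\<integral>w. X t w $ r \<partial>P) = (\<integral>w. row_val N True (Z t w) $ r \<partial>P)" for r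
    by (rule Bochner_Integration.integral_cong) (use assms(11) t in \<open>simp_all add: row_val_def\<close>)
  have "covariance_matrix P (2 * N) (X t) = covariance_matrix P (2 * N) (\<lambda>w. row_val N True (Z t w))"
    unfolding covariance_matrix_def mean
    by (rule cong_mat[OF refl refl], simp, rule Bochner_Integration.integral_cong)
      (use assms(11) t in \<open>simp_all add: row_val_def\<close>)
  moreover have "complex_of_real 0 \<cdot>\<^sub>m eigproj N 0 + complex_of_real (\<sigma>\<^sup>2 / (2 * \<beta>)) \<cdot>\<^sub>m matrix_K N
      = complex_of_real (\<sigma>\<^sup>2 / (2 * \<beta>)) \<cdot>\<^sub>m matrix_K N"
    by (rule eq_matI) simp_all
  ultimately show "map_mat complex_of_real (covariance_matrix P (2 * N) (X t)) =
      four_block_mat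
        (complex_of_real (\<sigma>\<^sup>2 / (2 * \<alpha>\<^sup>2 * \<beta>)) \<cdot>\<^sub>m matrix_K N)
        (0\<^sub>m N N)
        (0\<^sub>m N N)
        (complex_of_real (\<sigma>\<^sup>2 / (2 * \<beta>)) \<cdot>\<^sub>m matrix_K N)
      + complex_of_real (\<sigma>\<^sup>2) \<cdot>\<^sub>m transient_sum N \<alpha> \<beta> t"
    using cov[of True] by (simp only: if_True)
qed

end
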